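(* For every $s\ge0$, in the limit as $\delta\to0$, the weighted nonlocal operators converge strongly to their local analogues. That is, $$\lim_{\delta\to0}\|\mathcal D_S^\delta\{\boldsymbol V\}-\mathcal D_S^0\{\boldsymbol V\}\|_{H^{s-1}(\mathbb S^2,\mathbb R)}=0\quad\forall\,\boldsymbol V\in H^s(\mathbb S^2,\mathbb R^3),$$ $$\lim_{\delta\to0}\|\mathcal C_S^\delta\{\boldsymbol V\}-\mathcal C_S^0\{\boldsymbol V\}\|_{H^{s-1}(\mathbb S^2,\mathbb R)}=0\quad\forall\,\boldsymbol V\in H^s(\mathbb S^2,\mathbb R^3),$$ $$\lim_{\delta\to0}\|\boldsymbol{\mathcal G}_S^\delta\{u\}-\boldsymbol{\mathcal G}_S^0\{u\}\|_{H^{s-1}(\mathbb S^2,T\mathbb S^2)}=0\quad\forall\,u\in H^s(\mathbb S^2,\mathbb R),$$ $$\lim_{\delta\to0}\|\boldsymbol{\mathcal C}_S^\delta\{u\}-\boldsymbol{\mathcal C}_S^0\{u\}\|_{H^{s-1}(\mathbb S^2,T\mathbb S^2)}=0\quad\forall\,u\in H^s(\mathbb S^2,\mathbb R),$$ $$\lim_{\delta\to0}\|\boldsymbol{\mathcal C}^\delta\{\boldsymbol V\}-\boldsymbol{\mathcal C}^0\{\boldsymbol V\}\|_{H^{s-1}(\mathbb S^2,\mathbb R^3)}=0\quad\forall\,\boldsymbol V\in H^s(\mathbb S^2,\mathbb R^3),$$ $$\lim_{\delta\to0}\|(\boldsymbol{\mathcal C}^\delta)^*\{\boldsymbol V\}-(\boldsymbol{\mathcal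 C}^0)^*\{\boldsymbol V\}\|_{H^{s-1}(\mathbb S^2,\mathbb R^3)}=0\quad\forall\,\boldsymbol V\in H^s(\mathbb S^2,\mathbb R^3).$$
   Context: Expansions. $Y_{\ell,m}$ ($\ell\ge0$, $-\ell\le m\le\ell$) are the $L^2(\mathbb S^2)$-orthonormal spherical harmonics on the unit sphere $\mathbb S^2\subset\mathbb R^3$. Scalar fields are expanded as $u=\sum_{\ell,m}u_{\ell,m}Y_{\ell,m}$ and vector fields as $\boldsymbol V=\sum_{\ell,m}(V^s_{\ell,m}\nabla_SY_{\ell,m}+V^t_{\ell,m}\boldsymbol x\times\nabla_SY_{\ell,m}+V^x_{\ell,m}Y_{\ell,m}\boldsymbol x)$, where $\nabla_S$ is the surface gradient, $\boldsymbol x$ the outward unit normal, and $V^s_{0,0}=V^t_{0,0}=0$ (as $\nabla_SY_{0,0}=0$). Tangential fields have all $V^x_{\ell,m}=0$. Sobolev spaces. For $s\in\mathbb R$, $H^s(\mathbb S^2,\mathbb R)$, $H^s(\mathbb S^2,T\mathbb S^2)$, $H^s(\mathbb S^2,\mathbb R^3)$ are the completions of the smooth scalar, tangential, and $\mathbb R^3$-valued fields in the norms given by $\|u\|^2=\sum_{\ell,m}(\ell+\frac12)^{2s}|u_{\ell,m}|^2$, $\|\boldsymbol V\|^2=\sum_{\ell,m}(\ell+\frac12)^{2s+2}(|V^s_{\ell,m}|^2+|V^t_{\ell,m}|^2)$, and $\|\boldsymbol V\|^2=\sum_{\ell,m}\{(\ell+\frac12)^{2s+2}(|V^s_{\ell,m}|^2+|V^t_{\ell,m}|^2)+(\ell+\frac12)^{2s}|V^x_{\ell,m}|^2\}$,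 respectively. Kernel. Fix $-1<a<1$; let $0<\delta\le2$ be the horizon and $\chi_{[0,\delta]}$ the indicator function of $[0,\delta]$. The kernel is defined from $$\gamma_\delta'(t)=\sqrt{\tfrac{1+a}{\pi}}\,\frac{2^{a/2}}{\delta^{1+a}}\,\frac{1}{(1-t)^{(2-a)/2}}\,\frac1{\sqrt{1+t}}\,\chi_{[0,\delta]}(\sqrt{2(1-t)}),$$ for which $\sqrt{1-t^2}\,\gamma_\delta'\in L^1(-1,1)$; integrating gives, on $(-1,1)$ and for $a\ne0$, $$\gamma_\delta(t)=\Big\{\tfrac1{2\pi}\tfrac2{\delta^2}+\tfrac1a\sqrt{\tfrac{2(1+a)}{\pi\delta^2}}\Big[\tfrac{2}{2+a}\,{}_2F_1(\tfrac12,\tfrac a2;\tfrac{4+a}2;\tfrac{\delta^2}4)-\big(\tfrac{2(1-t)}{\delta^2}\big)^{a/2}{}_2F_1(\tfrac12,\tfrac a2;\tfrac{2+a}2;\tfrac{1-t}2)\Big]\Big\}\chi_{[0,\delta]}(\sqrt{2(1-t)}),$$ with the constant chosen such that $2\pi\int_{-1}^1\gamma_\delta(t)\,\mathrm dt=1$; for $a=0$ the formula is interpreted in the limiting sense. With $P_\ell$ the Legendre polynomial of degree $\ell$ and $\lambda_\ell\{f\}=2\pi\int_{-1}^1P_\ell(t)f(t)\,\mathrm dt$ for $f\in L^1(-1,1)$, set $\Lambda_\ell^\delta=\lambda_\ell\{\gamma_\delta\}$ and $\Theta_\ell^\delta=\lambda_\ell\{(1-t)\gamma_\delta'\}$. Weighted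 nonlocal operators (on expansions): $\mathcal D_S^\delta\{\boldsymbol V\}=-\sum\Lambda_\ell^\delta\ell(\ell+1)V^s_{\ell,m}Y_{\ell,m}$; $\mathcal C_S^\delta\{\boldsymbol V\}=\sum\Lambda_\ell^\delta\ell(\ell+1)V^t_{\ell,m}Y_{\ell,m}$; $\boldsymbol{\mathcal G}_S^\delta\{u\}=\sum\Lambda_\ell^\delta u_{\ell,m}\nabla_SY_{\ell,m}$; $\boldsymbol{\mathcal C}_S^\delta\{u\}=\sum\Lambda_\ell^\delta u_{\ell,m}\boldsymbol x\times\nabla_SY_{\ell,m}$; $$\boldsymbol{\mathcal C}^\delta\{\boldsymbol V\}=\sum\{[-\Theta_0^\delta+\Theta_\ell^\delta-\Lambda_\ell^\delta]V^t_{\ell,m}\nabla_SY_{\ell,m}+([\Theta_0^\delta+\Theta_\ell^\delta-\Lambda_\ell^\delta]V^s_{\ell,m}-\Lambda_\ell^\delta V^x_{\ell,m})\boldsymbol x\times\nabla_SY_{\ell,m}-\Lambda_\ell^\delta\ell(\ell+1)V^t_{\ell,m}Y_{\ell,m}\boldsymbol x\},$$ $$(\boldsymbol{\mathcal C}^\delta)^*\{\boldsymbol V\}=\sum\{[\Theta_0^\delta+\Theta_\ell^\delta-\Lambda_\ell^\delta]V^t_{\ell,m}\nabla_SY_{\ell,m}+([-\Theta_0^\delta+\Theta_\ell^\delta-\Lambda_\ell^\delta]V^s_{\ell,m}-\Lambda_\ell^\delta V^x_{\ell,m})\boldsymbol x\times\nabla_SY_{\ell,m}-\Lambda_\ell^\delta\ell(\ell+1)V^t_{\ell,m}Y_{\ell,m}\boldsymbol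 x\}.$$ Local operators: $\mathcal D_S^0\{\boldsymbol V\}=\nabla_S\cdot\boldsymbol V$ (surface divergence, which ignores the normal component: $\nabla_S\cdot(u\boldsymbol x)=0$), $\mathcal C_S^0\{\boldsymbol V\}=\nabla_S\cdot(\boldsymbol x\times\boldsymbol V)$, $\boldsymbol{\mathcal G}_S^0=\nabla_S$, $\boldsymbol{\mathcal C}_S^0=\boldsymbol x\times\nabla_S$; on expansions $\mathcal D_S^0\{\boldsymbol V\}=-\sum\ell(\ell+1)V^s_{\ell,m}Y_{\ell,m}$; $\mathcal C_S^0\{\boldsymbol V\}=\sum\ell(\ell+1)V^t_{\ell,m}Y_{\ell,m}$; $\boldsymbol{\mathcal G}_S^0\{u\}=\sum u_{\ell,m}\nabla_SY_{\ell,m}$; $\boldsymbol{\mathcal C}_S^0\{u\}=\sum u_{\ell,m}\boldsymbol x\times\nabla_SY_{\ell,m}$; and the curl and its $L^2$-adjoint are $$\boldsymbol{\mathcal C}^0\{\boldsymbol V\}=\sum\{-V^t_{\ell,m}\nabla_SY_{\ell,m}+(V^s_{\ell,m}-V^x_{\ell,m})\boldsymbol x\times\nabla_SY_{\ell,m}-\ell(\ell+1)V^t_{\ell,m}Y_{\ell,m}\boldsymbol x\},$$ $$(\boldsymbol{\mathcal C}^0)^*\{\boldsymbol V\}=\sum\{V^t_{\ell,m}\nabla_SY_{\ell,m}+(-V^s_{\ell,m}-V^x_{\ell,m})\boldsymbol x\times\nabla_SY_{\ell,m}-\ell(\ell+1)V^t_{\ell,m}Y_{\ell,m}\boldsymbol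 x\}.$$
   Formalization: In Θ_ℓ, γ_δ' is taken as the distributional derivative of γ_δ, adding the point mass from its jump at t = 1 − δ²/2; with the displayed pointwise γ_δ' alone, Θ_ℓ → 0 and the limits for the curl and its adjoint fail. *)

theory Defs
  imports "HOL-Analysis.Analysis"
begin

section \<open>The unit sphere, smooth fields and spherical harmonics\<close>

text \<open>Functions on the unit sphere are represented by functions on \<^typ>\<open>real^3\<close> of which only the
  values on \<^term>\<open>sphere 0 1\<close> matter. Differential notions are those of the extension
  that is constant along rays, i.e. of the composition with \<^const>\<open>sgn\<close> (\<open>x / |x|\<close> away from \<open>0\<close>).\<close>

definition spherical_point :: "real \<Rightarrow> real \<Rightarrow> real^3" where
  "spherical_point \<theta> \<phi> = vector [sin \<theta> * cos \<phi>, sin \<theta> * sin \<phi>, cos \<theta>]"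

definition sphere_measure :: "(real^3) measure" where
  "sphere_measure =
     distr (density lborel
              (\<lambda>(\<theta>, \<phi>). ennreal (sin \<theta>) * indicator ({0..pi} \<times> {0..2 * pi}) (\<theta>, \<phi>)))
           borel (\<lambda>(\<theta>, \<phi>). spherical_point \<theta> \<phi>)"

primrec k_times_differentiable_on ::
    "nat \<Rightarrow> (real^3 \<Rightarrow> 'b::real_normed_vector) \<Rightarrow> (real^3) set \<Rightarrow> bool" where
  "k_times_differentiable_on 0 f S \<longleftrightarrow> continuous_on S f"
| "k_times_differentiable_on (Suc k) f S \<longleftrightarrow>
     (\<forall>x\<in>S. f differentiable (at x)) \<and>
     (\<forall>v. k_times_differentiable_on k (\<lambda>x. frechet_derivative f (at x) v) S)"

definition smooth_on_sphere :: "(real^3 \<Rightarrow> 'b::real_normed_vector) \<Rightarrow> bool" where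
  "smooth_on_sphere f \<longleftrightarrow> (\<forall>k. k_times_differentiable_on k (\<lambda>x. f (sgn x)) (- {0}))"

definition surface_gradient :: "(real^3 \<Rightarrow> complex) \<Rightarrow> real^3 \<Rightarrow> complex^3" where
  "surface_gradient f x =
     (\<chi> i. vector_derivative (\<lambda>t. f (sgn (x + t *\<^sub>R axis i 1))) (at 0))"

definition cross3_complex :: "real^3 \<Rightarrow> complex^3 \<Rightarrow> complex^3" where
  "cross3_complex x v =
     (\<chi> i. Complex (cross3 x (\<chi> j. Re (v $ j)) $ i) (cross3 x (\<chi> j. Im (v $ j)) $ i))"

definition laplacian :: "(real^3 \<Rightarrow> complex) \<Rightarrow> real^3 \<Rightarrow> complex" where
  "laplacian p x =
     (\<Sum>i\<in>UNIV. ((\<lambda>g t. vector_derivative g (at t)) ^^ 2) (\<lambda>t. p (x + t *\<^sub>R axis i 1)) 0)"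

definition harmonic_homogeneous_polynomial :: "nat \<Rightarrow> (real^3 \<Rightarrow> complex) \<Rightarrow> bool" where
  "harmonic_homogeneous_polynomial l p \<longleftrightarrow>
     (\<exists>c :: nat \<Rightarrow> nat \<Rightarrow> nat \<Rightarrow> complex. \<forall>x.
        p x = (\<Sum>(i, j, k) | i + j + k = l.
                 c i j k * of_real ((x $ 1) ^ i * (x $ 2) ^ j * (x $ 3) ^ k))) \<and>
     (\<forall>x. laplacian p x = 0)"

definition spherical_harmonic :: "nat \<Rightarrow> (real^3 \<Rightarrow> complex) \<Rightarrow> bool" where
  "spherical_harmonic l f \<longleftrightarrow>
     (\<exists>p. harmonic_homogeneous_polynomial l p \<and> (\<forall>x\<in>sphere 0 1. f x = p x))"

definition modes :: "(nat \<times> int) set" where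
  "modes = {(l, m). - int l \<le> m \<and> m \<le> int l}"

text \<open>Any orthonormal choice of the \<open>Y l m\<close> is allowed, in particular the usual real ones
  and the usual complex ones, with any phase convention.\<close>

definition orthonormal_spherical_harmonics :: "(nat \<Rightarrow> int \<Rightarrow> real^3 \<Rightarrow> complex) \<Rightarrow> bool" where
  "orthonormal_spherical_harmonics Y \<longleftrightarrow>
     (\<forall>(l, m)\<in>modes. spherical_harmonic l (Y l m)) \<and>
     (\<forall>(l, m)\<in>modes. \<forall>(l', m')\<in>modes.
        (LINT x|sphere_measure. Y l m x * cnj (Y l' m' x)) =
        (if (l, m) = (l', m') then 1 else 0))"

section \<open>Expansions and Sobolev spaces\<close>

text \<open>A scalar expansion is a family of coefficients \<open>u l m\<close>; a tangential one is a pair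
  \<open>(V\<^sup>s, V\<^sup>t)\<close> and a general vector one a triple \<open>(V\<^sup>s, V\<^sup>t, V\<^sup>x)\<close> of such families, so that
  differences of expansions are the library's pointwise ones. Only indices in
  \<^const>\<open>modes\<close> are meaningful.\<close>

type_synonym coeffs = "nat \<Rightarrow> int \<Rightarrow> complex"

definition scalar_partial_sum ::
    "(nat \<Rightarrow> int \<Rightarrow> real^3 \<Rightarrow> complex) \<Rightarrow> coeffs \<Rightarrow> nat \<Rightarrow> real^3 \<Rightarrow> complex" where
  "scalar_partial_sum Y u N x = (\<Sum>l\<le>N. \<Sum>m = - int l..int l. u l m * Y l m x)"

definition vector_partial_sum ::
    "(nat \<Rightarrow> int \<Rightarrow> real^3 \<Rightarrow> complex) \<Rightarrow> coeffs \<times> coeffs \<times> coeffs \<Rightarrow> nat \<Rightarrow> real^3 \<Rightarrow> complex^3" where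
  "vector_partial_sum Y = (\<lambda>(Vs, Vt, Vx) N x.
     \<Sum>l\<le>N. \<Sum>m = - int l..int l.
       Vs l m *s surface_gradient (Y l m) x +
       Vt l m *s cross3_complex x (surface_gradient (Y l m) x) +
       (Vx l m * Y l m x) *s (\<chi> i. of_real (x $ i)))"

definition scalar_expansion ::
    "(nat \<Rightarrow> int \<Rightarrow> real^3 \<Rightarrow> complex) \<Rightarrow> (real^3 \<Rightarrow> real) \<Rightarrow> coeffs \<Rightarrow> bool" where
  "scalar_expansion Y f u \<longleftrightarrow>
     (\<lambda>N. \<integral>\<^sup>+x. ennreal ((norm (of_real (f x) - scalar_partial_sum Y u N x))\<^sup>2)
            \<partial>sphere_measure) \<longlonglongrightarrow> 0"

definition vector_expansion ::
    "(nat \<Rightarrow> int \<Rightarrow> real^3 \<Rightarrow> complex) \<Rightarrow> (real^3 \<Rightarrow> real^3) \<Rightarrow> coeffs \<times> coeffs \<times> coeffs \<Rightarrow> bool" where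
  "vector_expansion Y F = (\<lambda>(Vs, Vt, Vx).
     Vs 0 0 = 0 \<and> Vt 0 0 = 0 \<and>
     (\<lambda>N. \<integral>\<^sup>+x. ennreal ((norm ((\<chi> i. of_real (F x $ i)) - vector_partial_sum Y (Vs, Vt, Vx) N x))\<^sup>2)
            \<partial>sphere_measure) \<longlonglongrightarrow> 0)"

text \<open>The norms take the value \<open>\<infinity>\<close> when the defining series diverges.\<close>

definition ell2_norm :: "(nat \<Rightarrow> int \<Rightarrow> real) \<Rightarrow> ennreal" where
  "ell2_norm q =
     (if (\<lambda>(l, m). q l m) summable_on modes
      then ennreal (sqrt (\<Sum>\<^sub>\<infinity>(l, m)\<in>modes. q l m)) else \<infinity>)"

definition scalar_norm :: "real \<Rightarrow> coeffs \<Rightarrow> ennreal" where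
  "scalar_norm s u = ell2_norm (\<lambda>l m. (real l + 1/2) powr (2 * s) * (cmod (u l m))\<^sup>2)"

definition tangential_norm :: "real \<Rightarrow> coeffs \<times> coeffs \<Rightarrow> ennreal" where
  "tangential_norm s = (\<lambda>(Vs, Vt). ell2_norm (\<lambda>l m.
     (real l + 1/2) powr (2 * s + 2) * ((cmod (Vs l m))\<^sup>2 + (cmod (Vt l m))\<^sup>2)))"

definition vector_norm :: "real \<Rightarrow> coeffs \<times> coeffs \<times> coeffs \<Rightarrow> ennreal" where
  "vector_norm s = (\<lambda>(Vs, Vt, Vx). ell2_norm (\<lambda>l m.
     (real l + 1/2) powr (2 * s + 2) * ((cmod (Vs l m))\<^sup>2 + (cmod (Vt l m))\<^sup>2) +
     (real l + 1/2) powr (2 * s) * (cmod (Vx l m))\<^sup>2))"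

text \<open>The coefficient map embeds the smooth fields isometrically into a weighted \<open>\<ell>\<^sup>2\<close> space,
  which is complete; their completion is therefore the closure of the image.\<close>

definition sobolev_scalar :: "(nat \<Rightarrow> int \<Rightarrow> real^3 \<Rightarrow> complex) \<Rightarrow> real \<Rightarrow> coeffs set" where
  "sobolev_scalar Y s = {u. scalar_norm s u < \<infinity> \<and>
     (\<forall>\<epsilon>>0. \<exists>f w. smooth_on_sphere f \<and> scalar_expansion Y f w \<and> scalar_norm s (u - w) < \<epsilon>)}"

definition sobolev_vector ::
    "(nat \<Rightarrow> int \<Rightarrow> real^3 \<Rightarrow> complex) \<Rightarrow> real \<Rightarrow> (coeffs \<times> coeffs \<times> coeffs) set" where
  "sobolev_vector Y s = {V. vector_norm s V < \<infinity> \<and>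
     (\<forall>\<epsilon>>0. \<exists>F W. smooth_on_sphere F \<and> vector_expansion Y F W \<and> vector_norm s (V - W) < \<epsilon>)}"

section \<open>The kernel\<close>

definition kernel_deriv :: "real \<Rightarrow> real \<Rightarrow> real \<Rightarrow> real" where
  "kernel_deriv a \<delta> t =
     sqrt ((1 + a) / pi) * (2 powr (a / 2) / \<delta> powr (1 + a)) *
     (1 / (1 - t) powr ((2 - a) / 2)) * (1 / sqrt (1 + t)) *
     indicator {0..\<delta>} (sqrt (2 * (1 - t)))"

text \<open>The support of the kernel is \<open>[1 - \<delta>\<^sup>2/2, 1]\<close>; on it the kernel is an antiderivative of
  \<^const>\<open>kernel_deriv\<close>, the constant of integration being fixed by the normalisation. This
  covers \<open>a = 0\<close> as well; the closed form for \<open>a \<noteq> 0\<close> is \<open>kernel_closed_form\<close> below.\<close>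

definition kernel_primitive :: "real \<Rightarrow> real \<Rightarrow> real \<Rightarrow> real" where
  "kernel_primitive a \<delta> t = (LBINT \<tau>:{1 - \<delta>\<^sup>2 / 2..t}. kernel_deriv a \<delta> \<tau>)"

definition kernel_const :: "real \<Rightarrow> real \<Rightarrow> real" where
  "kernel_const a \<delta> = (THE c. 2 * pi * (LBINT t:{-1<..<1}.
     (c + kernel_primitive a \<delta> t) * indicator {0..\<delta>} (sqrt (2 * (1 - t)))) = 1)"

definition kernel :: "real \<Rightarrow> real \<Rightarrow> real \<Rightarrow> real" where
  "kernel a \<delta> t =
     (kernel_const a \<delta> + kernel_primitive a \<delta> t) * indicator {0..\<delta>} (sqrt (2 * (1 - t)))"

fun legendre_P :: "nat \<Rightarrow> real \<Rightarrow> real" where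
  "legendre_P 0 t = 1"
| "legendre_P (Suc 0) t = t"
| "legendre_P (Suc (Suc n)) t =
     ((2 * real n + 3) * t * legendre_P (Suc n) t - (real n + 1) * legendre_P n t) / (real n + 2)"

definition funk_hecke :: "nat \<Rightarrow> (real \<Rightarrow> real) \<Rightarrow> real" where
  "funk_hecke l f = 2 * pi * (LBINT t:{-1<..<1}. legendre_P l t * f t)"

definition Lam :: "real \<Rightarrow> real \<Rightarrow> nat \<Rightarrow> real" where
  "Lam a \<delta> l = funk_hecke l (kernel a \<delta>)"

text \<open>For \<open>\<delta> < 2\<close> the kernel jumps from \<open>0\<close> to \<open>kernel a \<delta> (1 - \<delta>\<^sup>2/2)\<close> at the cut-off
  \<open>t = 1 - \<delta>\<^sup>2/2\<close>. Its derivative on \<open>(-1, 1)\<close>, in the sense of distributions, is therefore the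
  function \<^const>\<open>kernel_deriv\<close> plus a point mass of that height at the cut-off. \<open>Theta\<close> pairs
  \<open>(1 - t) P\<^sub>l(t)\<close> with this derivative (for \<open>\<delta> = 2\<close> the cut-off is the end point \<open>-1\<close>). The point
  mass cannot be left out: the contribution of \<^const>\<open>kernel_deriv\<close> alone tends to \<open>0\<close> with
  \<open>\<delta>\<close>, see \<open>classical_part_of_Theta_vanishes\<close> below, and with it alone neither the nonlocal curl
  nor its adjoint would converge to the local one.\<close>

definition kernel_jump :: "real \<Rightarrow> real \<Rightarrow> real" where
  "kernel_jump a \<delta> = (if \<delta> < 2 then kernel a \<delta> (1 - \<delta>\<^sup>2 / 2) else 0)"

definition Theta :: "real \<Rightarrow> real \<Rightarrow> nat \<Rightarrow> real" where
  "Theta a \<delta> l =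
     funk_hecke l (\<lambda>t. (1 - t) * kernel_deriv a \<delta> t) +
     2 * pi * (legendre_P l (1 - \<delta>\<^sup>2 / 2) * (\<delta>\<^sup>2 / 2) * kernel_jump a \<delta>)"

section \<open>Weighted nonlocal operators and their local analogues\<close>

text \<open>\<open>tang\<close> enforces the convention that the coefficients of the vanishing fields
  \<open>\<nabla>\<^sub>S Y 0 0\<close> and \<open>x \<times> \<nabla>\<^sub>S Y 0 0\<close> are zero.\<close>

definition tang :: "coeffs \<Rightarrow> coeffs" where
  "tang u = (\<lambda>l m. if l = 0 then 0 else u l m)"

definition ll1 :: "nat \<Rightarrow> complex" where
  "ll1 l = of_nat (l * (l + 1))"

definition nonlocal_div :: "real \<Rightarrow> real \<Rightarrow> coeffs \<times> coeffs \<times> coeffs \<Rightarrow> coeffs" where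
  "nonlocal_div a \<delta> = (\<lambda>(Vs, Vt, Vx) l m. - (of_real (Lam a \<delta> l) * ll1 l * Vs l m))"

definition nonlocal_surface_curl :: "real \<Rightarrow> real \<Rightarrow> coeffs \<times> coeffs \<times> coeffs \<Rightarrow> coeffs" where
  "nonlocal_surface_curl a \<delta> = (\<lambda>(Vs, Vt, Vx) l m. of_real (Lam a \<delta> l) * ll1 l * Vt l m)"

definition nonlocal_grad :: "real \<Rightarrow> real \<Rightarrow> coeffs \<Rightarrow> coeffs \<times> coeffs" where
  "nonlocal_grad a \<delta> u = (tang (\<lambda>l m. of_real (Lam a \<delta> l) * u l m), \<lambda>l m. 0)"

definition nonlocal_rotated_grad :: "real \<Rightarrow> real \<Rightarrow> coeffs \<Rightarrow> coeffs \<times> coeffs" where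
  "nonlocal_rotated_grad a \<delta> u = (\<lambda>l m. 0, tang (\<lambda>l m. of_real (Lam a \<delta> l) * u l m))"

definition nonlocal_curl ::
    "real \<Rightarrow> real \<Rightarrow> coeffs \<times> coeffs \<times> coeffs \<Rightarrow> coeffs \<times> coeffs \<times> coeffs" where
  "nonlocal_curl a \<delta> = (\<lambda>(Vs, Vt, Vx).
     (tang (\<lambda>l m. of_real (- Theta a \<delta> 0 + Theta a \<delta> l - Lam a \<delta> l) * Vt l m),
      tang (\<lambda>l m. of_real (Theta a \<delta> 0 + Theta a \<delta> l - Lam a \<delta> l) * Vs l m
                   - of_real (Lam a \<delta> l) * Vx l m),
      \<lambda>l m. - (of_real (Lam a \<delta> l) * ll1 l * Vt l m)))"

definition nonlocal_curl_adj ::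
    "real \<Rightarrow> real \<Rightarrow> coeffs \<times> coeffs \<times> coeffs \<Rightarrow> coeffs \<times> coeffs \<times> coeffs" where
  "nonlocal_curl_adj a \<delta> = (\<lambda>(Vs, Vt, Vx).
     (tang (\<lambda>l m. of_real (Theta a \<delta> 0 + Theta a \<delta> l - Lam a \<delta> l) * Vt l m),
      tang (\<lambda>l m. of_real (- Theta a \<delta> 0 + Theta a \<delta> l - Lam a \<delta> l) * Vs l m
                   - of_real (Lam a \<delta> l) * Vx l m),
      \<lambda>l m. - (of_real (Lam a \<delta> l) * ll1 l * Vt l m)))"

definition local_div :: "coeffs \<times> coeffs \<times> coeffs \<Rightarrow> coeffs" where
  "local_div = (\<lambda>(Vs, Vt, Vx) l m. - (ll1 l * Vs l m))"

definition local_surface_curl :: "coeffs \<times> coeffs \<times> coeffs \<Rightarrow> coeffs" where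
  "local_surface_curl = (\<lambda>(Vs, Vt, Vx) l m. ll1 l * Vt l m)"

definition local_grad :: "coeffs \<Rightarrow> coeffs \<times> coeffs" where
  "local_grad u = (tang u, \<lambda>l m. 0)"

definition local_rotated_grad :: "coeffs \<Rightarrow> coeffs \<times> coeffs" where
  "local_rotated_grad u = (\<lambda>l m. 0, tang u)"

definition local_curl :: "coeffs \<times> coeffs \<times> coeffs \<Rightarrow> coeffs \<times> coeffs \<times> coeffs" where
  "local_curl = (\<lambda>(Vs, Vt, Vx).
     (tang (\<lambda>l m. - Vt l m), tang (\<lambda>l m. Vs l m - Vx l m), \<lambda>l m. - (ll1 l * Vt l m)))"

definition local_curl_adj :: "coeffs \<times> coeffs \<times> coeffs \<Rightarrow> coeffs \<times> coeffs \<times> coeffs" where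
  "local_curl_adj = (\<lambda>(Vs, Vt, Vx).
     (tang (\<lambda>l m. Vt l m), tang (\<lambda>l m. - Vs l m - Vx l m), \<lambda>l m. - (ll1 l * Vt l m)))"

section \<open>Closed form of the kernel and behaviour of its derivative\<close>

lemma FTC_nonneg_Icc:
  fixes f F :: "real \<Rightarrow> real"
  assumes "p < q" and F: "continuous_on {p..q} F"
    and D: "\<And>x. p < x \<Longrightarrow> x < q \<Longrightarrow> (F has_real_derivative f x) (at x)"
    and C: "\<And>x. p < x \<Longrightarrow> x < q \<Longrightarrow> isCont f x"
    and nn: "\<And>x. p < x \<Longrightarrow> x < q \<Longrightarrow> 0 \<le> f x"
  shows "set_integrable lborel {p<..<q} f" "(LBINT x:{p<..<q}. f x) = F q - F p"
proof -
  have A: "((F \<circ> real_of_ereal) \<longlongrightarrow> F p) (at_right (ereal p))"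
    using F \<open>p < q\<close> by (simp add: ereal_tendsto_simps continuous_on_Icc_at_rightD)
  have B: "((F \<circ> real_of_ereal) \<longlongrightarrow> F q) (at_left (ereal q))"
    using F \<open>p < q\<close> by (simp add: ereal_tendsto_simps continuous_on_Icc_at_leftD)
  note * = interval_integral_FTC_nonneg[of "ereal p" "ereal q" F f, OF _ _ _ _ A B]
  show "set_integrable lborel {p<..<q} f"
    using *(1) assms by simp
  show "(LBINT x:{p<..<q}. f x) = F q - F p"
    using *(2) assms by (simp add: interval_lebesgue_integral_def)
qed

lemma kernel_support:
  assumes "0 < \<delta>" "t \<le> (1::real)"
  shows "indicator {0..\<delta>} (sqrt (2 * (1 - t))) = (if 1 - \<delta>\<^sup>2 / 2 \<le> t then 1 else (0::real))"
proof -
  have "sqrt (2 * (1 - t)) \<le> \<delta> \<longleftrightarrow> 2 * (1 - t) \<le> \<delta>\<^sup>2"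
    using assms real_sqrt_le_iff[of "2 * (1 - t)" "\<delta>\<^sup>2"] by simp
  then show ?thesis using assms by (auto simp: indicator_def)
qed

definition half_coeff :: "nat \<Rightarrow> real" where "half_coeff n = pochhammer (1/2) n / fact n"

lemma half_coeff_pos: "0 < half_coeff n" by (simp add: half_coeff_def pochhammer_pos)

lemma half_coeff_Suc: "half_coeff (Suc n) = half_coeff n * ((2 * real n + 1) / (2 * real n + 2))"
  by (simp add: half_coeff_def pochhammer_Suc field_simps)

lemma half_coeff_summable: "summable (\<lambda>n. half_coeff n / (real n + 1))"
proof -
  have eq: "half_coeff n - half_coeff (Suc n) = 1/2 * (half_coeff n / (real n + 1))" for n
    unfolding half_coeff_Suc by (simp add: field_simps)
  have "decseq half_coeff"
    unfolding decseq_Suc_iff half_coeff_Suc using half_coeff_pos[THEN less_imp_le] by (intro allI mult_left_le) auto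
  then obtain L where "half_coeff \<longlonglongrightarrow> L"
    using decseq_convergent[of half_coeff 0] half_coeff_pos less_imp_le by metis
  from summable_mult[OF telescope_summable'[OF this], of 2] show ?thesis
    unfolding eq mult.assoc[symmetric] by simp
qed

lemma pochhammer_shift:
  assumes "(b::real) + n \<noteq> 0" "pochhammer (b+1) n \<noteq> 0"
  shows "pochhammer b n / pochhammer (b + 1) n = b / (b + n)"
proof -
  have "b * pochhammer (b+1) n = pochhammer b n * (b + n)"
    using pochhammer_rec[of b n] pochhammer_rec'[of b n] by (simp add: mult.commute)
  then show ?thesis using assms by (simp add: field_simps)
qed

lemma hypergeo1_nth:
  assumes "-1 < (b::real)" "b \<noteq> 0"
  shows "fps_nth (fps_hypergeo [1/2, b] [b + 1] 1) n = half_coeff n * (b / (b + n))"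
proof -
  have "b + n \<noteq> 0" using assms by (cases n) auto
  moreover have "pochhammer (b+1) n \<noteq> 0" using assms pochhammer_pos[of "b+1" n] by auto
  ultimately have "pochhammer b n / pochhammer (b + 1) n = b / (b + n)"
    by (rule pochhammer_shift)
  moreover have "fps_nth (fps_hypergeo [1/2, b] [b + 1] 1) n = half_coeff n * (pochhammer b n / pochhammer (b + 1) n)"
    by (simp add: half_coeff_def)
  ultimately show ?thesis by simp
qed

lemma hypergeo2_nth:
  assumes "-1 < (b::real)" "b \<noteq> 0"
  shows "fps_nth (fps_hypergeo [1/2, b] [b + 2] 1) n = half_coeff n * (b / (b + n)) * ((b + 1) / (b + 1 + n))"
proof -
  have "b + n \<noteq> 0" using assms by (cases n) auto
  moreover have p: "0 < pochhammer (b + 1) n" "0 < pochhammer (b + 1 + 1) n" "b + 1 + n \<noteq> 0"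
    using assms by (auto intro!: pochhammer_pos)
  ultimately have "pochhammer b n / pochhammer (b + 1) n = b / (b + n)"
    "pochhammer (b + 1) n / pochhammer (b + 1 + 1) n = (b + 1) / (b + 1 + n)"
    by (intro pochhammer_shift; simp)+
  moreover have "fps_nth (fps_hypergeo [1/2, b] [b + 1 + 1] 1) n
      = half_coeff n * (pochhammer b n / pochhammer (b + 1) n) * (pochhammer (b + 1) n / pochhammer (b + 1 + 1) n)"
    using p by (simp add: half_coeff_def)
  moreover have "b + 1 + 1 = b + 2" by simp
  ultimately show ?thesis by (simp only:)
qed

lemma eval_fps_abs_summable:
  fixes f :: "real fps"
  assumes "summable (\<lambda>n. \<bar>fps_nth f n\<bar>)"
  shows "continuous_on {-1..1} (eval_fps f)" "1 \<le> fps_conv_radius f"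
proof -
  have "uniform_limit {-1..1} (\<lambda>n x. \<Sum>i<n. fps_nth f i * x ^ i) (eval_fps f) sequentially"
    unfolding eval_fps_def
  proof (rule Weierstrass_m_test[OF _ assms])
    fix n and x :: real assume "x \<in> {-1..1}"
    then have "\<bar>x\<bar> ^ n \<le> 1" by (intro power_le_one) auto
    then show "norm (fps_nth f n * x ^ n) \<le> \<bar>fps_nth f n\<bar>"
      by (simp add: abs_mult power_abs mult_left_le)
  qed
  then show "continuous_on {-1..1} (eval_fps f)"
    by (rule uniform_limit_theorem[rotated]) (auto intro!: continuous_intros always_eventually)
  have "summable (\<lambda>n. fps_nth f n * 1 ^ n)"
    using summable_rabs_cancel[OF assms] by simp
  from conv_radius_geI[OF this] show "1 \<le> fps_conv_radius f"
    by (simp add: fps_conv_radius_def one_ereal_def)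
qed

lemma hypergeo_abs_summable:
  assumes "-1/2 < (b::real)" "b < 1/2" "b \<noteq> 0"
  shows "summable (\<lambda>n. \<bar>fps_nth (fps_hypergeo [1/2, b] [b + 1] 1) n\<bar>)" (is ?A)
    "summable (\<lambda>n. \<bar>fps_nth (fps_hypergeo [1/2, b] [b + 2] 1) n\<bar>)" (is ?B)
proof -
  have le: "\<bar>b / (b + real n)\<bar> \<le> 2 / (real n + 1)" if "n \<ge> 1" for n
  proof -
    have "0 < b + real n" using that assms by linarith
    moreover have "\<bar>b\<bar> * (real n + 1) \<le> 1/2 * (real n + 1)"
      by (rule mult_right_mono) (use assms in auto)
    moreover have "1/2 * (real n + 1) \<le> 2 * (b + real n)"
      using that assms by (simp add: field_simps)
    ultimately show ?thesis by (simp add: abs_div field_simps)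
  qed
  have S: "summable (\<lambda>n. 2 * (half_coeff n / (real n + 1)))"
    by (intro summable_mult half_coeff_summable)
  have 1: "\<bar>fps_nth (fps_hypergeo [1/2, b] [b + 1] 1) n\<bar> \<le> 2 * (half_coeff n / (real n + 1))" if "n \<ge> 1" for n
  proof -
    have "\<bar>fps_nth (fps_hypergeo [1/2, b] [b + 1] 1) n\<bar> = half_coeff n * \<bar>b / (b + real n)\<bar>"
      using assms half_coeff_pos[of n] by (subst hypergeo1_nth) (auto simp: abs_mult)
    also have "\<dots> \<le> half_coeff n * (2 / (real n + 1))"
      using le[OF that] half_coeff_pos[of n] by (intro mult_left_mono) auto
    also have "\<dots> = 2 * (half_coeff n / (real n + 1))" by simp
    finally show ?thesis .
  qed
  have 2: "\<bar>fps_nth (fps_hypergeo [1/2, b] [b + 2] 1) n\<bar> \<le> \<bar>fps_nth (fps_hypergeo [1/2, b] [b + 1] 1) n\<bar>" for n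
  proof -
    have "\<bar>(b + 1) / (b + 1 + n)\<bar> \<le> 1" using assms by (simp add: abs_div)
    from mult_left_mono[OF this, of "\<bar>half_coeff n * (b / (b + n))\<bar>"]
    show ?thesis using assms by (simp add: hypergeo1_nth hypergeo2_nth abs_mult del: fps_hypergeo_nth)
  qed
  show A: ?A
    by (rule summable_comparison_test'[OF S, of 1]) (use 1 in \<open>simp del: fps_hypergeo_nth\<close>)
  show ?B
    by (rule summable_comparison_test'[OF A, of 0]) (use 2 in \<open>simp del: fps_hypergeo_nth\<close>)
qed

lemma half_coeff_binomial:
  assumes "\<bar>z\<bar> < 1"
  shows "(\<lambda>n. half_coeff n * z ^ n) sums (1 / sqrt (1 - z))"
proof -
  have "((-1/2) gchoose n) * (-z) ^ n = half_coeff n * z ^ n" for n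
    by (simp add: gbinomial_pochhammer half_coeff_def power_minus')
  with gen_binomial_real[of "-z" "-1/2"] assms show ?thesis
    by (simp add: powr_minus powr_half_sqrt field_simps)
qed

lemma powr_eval_fps_deriv:
  fixes f g :: "real fps"
  assumes rf: "1 \<le> fps_conv_radius f" and eq: "\<And>n. (\<beta> + n) * fps_nth f n = fps_nth g n"
    and z: "0 < z" "z < 1"
  shows "((\<lambda>z. z powr \<beta> * eval_fps f z) has_real_derivative z powr (\<beta> - 1) * eval_fps g z) (at z)"
proof -
  have nz: "ereal (norm z) < fps_conv_radius f"
    using z by (intro less_le_trans[OF _ rf]) (simp add: one_ereal_def)
  have nz': "ereal (norm z) < fps_conv_radius (fps_deriv f)"
    using nz fps_conv_radius_deriv[of f] by (rule less_le_trans)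
  have g: "g = fps_X * fps_deriv f + fps_const \<beta> * f"
  proof (rule fps_ext)
    fix n show "fps_nth g n = fps_nth (fps_X * fps_deriv f + fps_const \<beta> * f) n"
      by (cases n) (auto simp flip: eq simp: algebra_simps)
  qed
  have r1: "ereal (norm z) < fps_conv_radius (fps_X * fps_deriv f)"
    by (rule less_le_trans[OF _ fps_conv_radius_mult]) (use nz' in auto)
  have r2: "ereal (norm z) < fps_conv_radius (fps_const \<beta> * f)"
    by (rule less_le_trans[OF _ fps_conv_radius_mult]) (use nz in auto)
  have "eval_fps g z = z * eval_fps (fps_deriv f) z + \<beta> * eval_fps f z"
    unfolding g using nz nz' r1 r2 by (simp add: eval_fps_add eval_fps_mult)
  moreover have "((\<lambda>z. z powr \<beta> * eval_fps f z) has_real_derivative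
      \<beta> * z powr (\<beta> - 1) * eval_fps f z + eval_fps (fps_deriv f) z * z powr \<beta>) (at z)"
    by (rule DERIV_mult has_field_derivative_eval_fps has_real_derivative_powr nz z)+
  moreover have "z powr \<beta> = z * z powr (\<beta> - 1)"
    using z by (simp add: powr_mult_base)
  ultimately show ?thesis by (simp add: algebra_simps)
qed

lemma hypergeo_has_deriv:
  assumes "-1/2 < (b::real)" "b < 1/2" "b \<noteq> 0" "0 < z" "z < 1"
  shows "((\<lambda>z. z powr b * eval_fps (fps_hypergeo [1/2, b] [b + 1] 1) z)
           has_real_derivative b * z powr (b - 1) / sqrt (1 - z)) (at z)"
    and "((\<lambda>z. z powr (b + 1) * eval_fps (fps_hypergeo [1/2, b] [b + 2] 1) z)
           has_real_derivative (b + 1) * (z powr b * eval_fps (fps_hypergeo [1/2, b] [b + 1] 1) z)) (at z)"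
proof -
  note S = hypergeo_abs_summable[OF assms(1-3)]
  have 1: "(b + real n) * fps_nth (fps_hypergeo [1/2, b] [b + 1] 1) n
      = fps_nth (Abs_fps (\<lambda>n. b * half_coeff n)) n" for n
  proof -
    have "b + real n \<noteq> 0" using assms by (cases n) auto
    then show ?thesis using assms by (subst hypergeo1_nth) auto
  qed
  have 2: "(b + 1 + real n) * fps_nth (fps_hypergeo [1/2, b] [b + 2] 1) n
      = fps_nth (fps_const (b + 1) * fps_hypergeo [1/2, b] [b + 1] 1) n" for n
  proof -
    have "b + 1 + real n \<noteq> 0" using assms by auto
    then show ?thesis using assms
      by (simp add: hypergeo1_nth hypergeo2_nth del: fps_hypergeo_nth)
  qed
  have g: "eval_fps (Abs_fps (\<lambda>n. b * half_coeff n)) z = b / sqrt (1 - z)"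
    using sums_mult[OF half_coeff_binomial[of z], of b] assms
    by (simp add: eval_fps_def sums_iff mult.assoc)
  have r: "ereal (norm z) < fps_conv_radius (fps_hypergeo [1/2, b] [b + 1] 1)"
    using assms by (intro less_le_trans[OF _ eval_fps_abs_summable(2)[OF S(1)]]) (simp add: one_ereal_def)
  show "((\<lambda>z. z powr b * eval_fps (fps_hypergeo [1/2, b] [b + 1] 1) z)
           has_real_derivative b * z powr (b - 1) / sqrt (1 - z)) (at z)"
    using powr_eval_fps_deriv[OF eval_fps_abs_summable(2)[OF S(1)] 1 assms(4,5)]
    by (simp add: g mult.commute)
  show "((\<lambda>z. z powr (b + 1) * eval_fps (fps_hypergeo [1/2, b] [b + 2] 1) z)
           has_real_derivative (b + 1) * (z powr b * eval_fps (fps_hypergeo [1/2, b] [b + 1] 1) z)) (at z)"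
    using powr_eval_fps_deriv[OF eval_fps_abs_summable(2)[OF S(2)] 2 assms(4,5)] r
    by (simp add: eval_fps_mult mult_ac)
qed

lemma kernel_deriv_on_support:
  assumes "-1 < a" "0 < \<delta>" "\<delta> \<le> 2" "1 - \<delta>\<^sup>2 / 2 \<le> t" "t < 1" "-1 < t"
  shows "kernel_deriv a \<delta> t = sqrt (2 * (1 + a) / (pi * \<delta>\<^sup>2)) / (4 * (\<delta>\<^sup>2 / 4) powr (a / 2))
     * (((1 - t) / 2) powr (a / 2 - 1) / sqrt (1 - (1 - t) / 2))"
proof -
  define z where "z = (1 - t) / 2"
  have t: "1 - t = 2 * z" "1 + t = 2 * (1 - z)" and z: "0 < z" "z < 1"
    using assms by (auto simp: z_def field_simps)
  have e1: "1 / (2 * z) powr ((2 - a) / 2) = 2 powr (a / 2 - 1) * z powr (a / 2 - 1)"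
  proof -
    have "(2 - a) / 2 = - (a / 2 - 1)" by simp
    then show ?thesis using z by (simp only: powr_minus powr_mult) (simp add: field_simps)
  qed
  have e2: "(\<delta>\<^sup>2 / 4) powr (a / 2) = \<delta> powr a / 2 powr a"
  proof -
    have "\<delta>\<^sup>2 / 4 = (\<delta> / 2) powr 2" using assms by (simp add: power_divide)
    then have "(\<delta>\<^sup>2 / 4) powr (a / 2) = (\<delta> / 2) powr a" by (simp only: powr_powr) simp
    then show ?thesis using assms by (simp add: powr_divide)
  qed
  have e3: "\<delta> powr (1 + a) = \<delta> * \<delta> powr a" using assms by (simp add: powr_add)
  have e4: "2 powr (a / 2) * 2 powr (a / 2 - 1) = 2 powr a / 2"
    by (simp flip: powr_add add: powr_diff)
  have e5: "sqrt (2 * (1 + a) / (pi * \<delta>\<^sup>2)) = sqrt 2 * sqrt ((1 + a) / pi) / \<delta>"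
  proof -
    have "2 * (1 + a) / (pi * \<delta>\<^sup>2) = 2 * ((1 + a) / pi) / \<delta>\<^sup>2" by simp
    then show ?thesis using assms by (simp only: real_sqrt_mult real_sqrt_divide real_sqrt_abs abs_of_pos)
  qed
  have "kernel_deriv a \<delta> t = sqrt ((1 + a) / pi) / (\<delta> * \<delta> powr a) *
      (2 powr (a / 2) * 2 powr (a / 2 - 1)) * z powr (a / 2 - 1) * (1 / (sqrt 2 * sqrt (1 - z)))"
  proof -
    have "indicator {0..\<delta>} (sqrt (2 * (2 * z))) = (1::real)"
      using assms kernel_support[of \<delta> t] unfolding t by simp
    then show ?thesis unfolding kernel_deriv_def t e1 e3 real_sqrt_mult[of 2 "1 - z"] by simp
  qed
  also have "\<dots> = sqrt ((1 + a) / pi) / (\<delta> * \<delta> powr a) *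
      (2 powr a * (sqrt 2 / 4)) * (z powr (a / 2 - 1) / sqrt (1 - z))"
  proof -
    have "1 / (sqrt 2 * y) = sqrt 2 / 2 / y" for y :: real
    proof -
      have "1 / (sqrt 2 * y) = (sqrt 2 * sqrt 2) / 2 / (sqrt 2 * y)" by simp
      also have "\<dots> = sqrt 2 / 2 / y" by (simp del: real_sqrt_mult_self)
      finally show ?thesis .
    qed
    then show ?thesis unfolding e4 by (simp add: mult_ac)
  qed
  also have "\<dots> = sqrt (2 * (1 + a) / (pi * \<delta>\<^sup>2)) / (4 * (\<delta>\<^sup>2 / 4) powr (a / 2))
     * (z powr (a / 2 - 1) / sqrt (1 - z))"
    unfolding e2 e5 by (simp add: field_simps)
  finally show ?thesis unfolding z_def .
qed

lemma kernel_closed_form: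
  assumes a: "-1 < a" "a < 1" "a \<noteq> 0" and d: "0 < \<delta>" "\<delta> \<le> 2" and t: "-1 < t" "t < 1"
  shows "kernel a \<delta> t =
    (1 / (2 * pi) * (2 / \<delta>\<^sup>2) + 1 / a * sqrt (2 * (1 + a) / (pi * \<delta>\<^sup>2)) *
       (2 / (2 + a) * eval_fps (fps_hypergeo [1/2, a/2] [(4 + a)/2] 1) (\<delta>\<^sup>2 / 4)
        - (2 * (1 - t) / \<delta>\<^sup>2) powr (a / 2) *
          eval_fps (fps_hypergeo [1/2, a/2] [(2 + a)/2] 1) ((1 - t) / 2)))
    * indicator {0..\<delta>} (sqrt (2 * (1 - t)))"
proof -
  define b Z t0 where "b = a / 2" and "Z = \<delta>\<^sup>2 / 4" and "t0 = 1 - \<delta>\<^sup>2 / 2"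
  define K where "K = sqrt (2 * (1 + a) / (pi * \<delta>\<^sup>2))"
  define F1 F2 where "F1 = eval_fps (fps_hypergeo [1/2, b] [b + 1] 1)"
    and "F2 = eval_fps (fps_hypergeo [1/2, b] [b + 2] 1)"
  define G where "G t = - (K / (a * Z powr b)) * (((1 - t) / 2) powr b * F1 ((1 - t) / 2))" for t
  define M where "M t = (2 * K / (a * Z powr b * (b + 1))) * (((1 - t) / 2) powr (b + 1) * F2 ((1 - t) / 2))" for t
  have b: "-1/2 < b" "b < 1/2" "b \<noteq> 0" using a by (auto simp: b_def)
  have ab: "a = 2 * b" by (simp add: b_def)
  have "\<delta> * \<delta> \<le> 2 * 2" using d by (intro mult_mono) auto
  then have Z: "0 < Z" "Z \<le> 1" using d by (auto simp: Z_def power2_eq_square)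
  have t0: "t0 = 1 - 2 * Z" "-1 \<le> t0" "t0 < 1" using Z by (auto simp: t0_def Z_def)
  have K: "0 < K" using a d by (auto simp: K_def)
  have cF: "continuous_on {-1..1} F1" "continuous_on {-1..1} F2"
    unfolding F1_def F2_def by (intro eval_fps_abs_summable hypergeo_abs_summable b)+
  have cF': "continuous_on {-1..1} (\<lambda>t. F1 ((1 - t) / 2))" "continuous_on {-1..1} (\<lambda>t. F2 ((1 - t) / 2))"
    by (rule continuous_on_compose2[OF cF(1)] continuous_on_compose2[OF cF(2)], auto intro!: continuous_intros)+
  have cG: "continuous_on {t0..x} G" if "x < 1" for x
    unfolding G_def using t0 that
    by (intro continuous_intros continuous_on_subset[OF cF'(1)]) auto
  have cM: "continuous_on {t0..1} M"
    unfolding M_def using t0 b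
    by (intro continuous_intros continuous_on_subset[OF cF'(2)] continuous_on_powr') auto
  have dG: "(G has_real_derivative kernel_deriv a \<delta> x) (at x)" if x: "t0 < x" "x < 1" for x
  proof -
    have *: "((\<lambda>t. (1 - t) / 2) has_real_derivative -1/2) (at x)"
      by (auto intro!: derivative_eq_intros)
    have "0 < (1 - x) / 2" "(1 - x) / 2 < 1" using x t0 by auto
    from DERIV_cmult[OF DERIV_chain2[OF hypergeo_has_deriv(1)[OF b this] *], of "- (K / (a * Z powr b))"]
    show ?thesis
      unfolding G_def F1_def using x t0 d a
      by (subst kernel_deriv_on_support) (auto simp: K_def Z_def b_def t0_def field_simps)
  qed
  have dM: "(M has_real_derivative G x) (at x)" if x: "t0 < x" "x < 1" for x
  proof -
    have *: "((\<lambda>t. (1 - t) / 2) has_real_derivative -1/2) (at x)"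
      by (auto intro!: derivative_eq_intros)
    have z: "0 < (1 - x) / 2" "(1 - x) / 2 < 1" using x t0 by auto
    have b1: "b + 1 \<noteq> 0" using b by auto
    have eq: "2 * K / (a * Z powr b * (b + 1)) * ((b + 1) * Y * (-1/2)) = - (K / (a * Z powr b)) * Y" for Y
    proof -
      have "2 * K / (A * B) * (B * Y * (-1/2)) = - (K / A) * Y" if "B \<noteq> 0" for A B
        using that by simp
      from this[OF b1] show ?thesis .
    qed
    from DERIV_cmult[OF DERIV_chain2[OF hypergeo_has_deriv(2)[OF b z] *], of "2 * K / (a * Z powr b * (b + 1))"]
    show ?thesis
      unfolding M_def F2_def G_def F1_def by (simp only: eq[symmetric] mult.assoc)
  qed
  have cont_deriv: "isCont (kernel_deriv a \<delta>) x" if x: "t0 < x" "x < 1" for x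
  proof -
    have "isCont (\<lambda>t. K / (4 * Z powr b) * (((1 - t) / 2) powr (b - 1) / sqrt (1 - (1 - t) / 2))) x"
      using x t0 by (intro continuous_intros) auto
    moreover have "\<forall>\<^sub>F t in nhds x. kernel_deriv a \<delta> t =
        K / (4 * Z powr b) * (((1 - t) / 2) powr (b - 1) / sqrt (1 - (1 - t) / 2))"
    proof (rule eventually_mono[OF eventually_nhds_in_open[of "{t0<..<1}" x]])
      fix t assume "t \<in> {t0<..<1}"
      then show "kernel_deriv a \<delta> t =
          K / (4 * Z powr b) * (((1 - t) / 2) powr (b - 1) / sqrt (1 - (1 - t) / 2))"
        unfolding K_def Z_def b_def using t0(2)
        by (intro kernel_deriv_on_support a d) (auto simp: t0_def)
    qed (use x in auto)
    ultimately show ?thesis by (subst isCont_cong) assumption+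
  qed
  have nn: "0 \<le> kernel_deriv a \<delta> x" if "t0 < x" "x < 1" for x
    using a d that t0 by (auto simp: kernel_deriv_def intro!: mult_nonneg_nonneg)
  have prim: "kernel_primitive a \<delta> x = G x - G t0" if x: "t0 \<le> x" "x < 1" for x
  proof (cases "x = t0")
    case True
    have "(LBINT \<tau>:{x..x}. kernel_deriv a \<delta> \<tau>) = (LBINT \<tau>=x..x. kernel_deriv a \<delta> \<tau>)"
      by (subst interval_integral_Icc) auto
    then show ?thesis using True by (simp add: kernel_primitive_def t0_def)
  next
    case False
    with x have lt: "t0 < x" by simp
    have "kernel_primitive a \<delta> x = (LBINT \<tau>=t0..x. kernel_deriv a \<delta> \<tau>)"
      using lt by (simp add: kernel_primitive_def interval_integral_Icc t0_def)
    also have "\<dots> = (LBINT \<tau>:{t0<..<x}. kernel_deriv a \<delta> \<tau>)"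
      using lt by (simp add: interval_integral_Ioo)
    also have "\<dots> = G x - G t0"
      by (rule FTC_nonneg_Icc(2)[OF lt cG]) (use x in \<open>auto intro!: dG cont_deriv nn\<close>)
    finally show ?thesis .
  qed
  have prim_nn: "0 \<le> G x - G t0" if "t0 < x" "x < 1" for x
  proof -
    have "0 \<le> indicat_real {t0..x} \<tau> *\<^sub>R kernel_deriv a \<delta> \<tau>" for \<tau>
      using a d t0(2) that by (auto simp: indicator_def kernel_deriv_def intro!: mult_nonneg_nonneg)
    then have "0 \<le> (LBINT \<tau>:{t0..x}. kernel_deriv a \<delta> \<tau>)"
      unfolding set_lebesgue_integral_def by (intro Bochner_Integration.integral_nonneg)
    then show ?thesis using prim[of x] that by (simp add: kernel_primitive_def t0_def)
  qed
  have "continuous_on {t0..1} (\<lambda>t. M t - G t0 * t)"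
    by (intro continuous_intros cM)
  moreover have "((\<lambda>t. M t - G t0 * t) has_real_derivative G x - G t0) (at x)" if "t0 < x" "x < 1" for x
    using dM[OF that] by (auto intro!: derivative_eq_intros)
  moreover have "isCont (\<lambda>x. G x - G t0) x" if "t0 < x" "x < 1" for x
    by (intro continuous_intros DERIV_isCont[OF dG[OF that]])
  ultimately have I: "set_integrable lborel {t0<..<1} (\<lambda>x. G x - G t0)"
      "(LBINT x:{t0<..<1}. G x - G t0) = (M 1 - G t0) - (M t0 - G t0 * t0)"
    using FTC_nonneg_Icc[OF t0(3), of "\<lambda>t. M t - G t0 * t" "\<lambda>x. G x - G t0"] prim_nn by auto
  have M1: "M 1 = 0" using b by (simp add: M_def)
  have Mt0: "M t0 = 2 * K * Z / (a * (b + 1)) * F2 Z"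
  proof -
    have "Z powr (b + 1) = Z powr b * Z" using Z by (simp add: powr_add)
    then show ?thesis using Z by (simp add: M_def t0 powr_add)
  qed
  have norm: "2 * pi * (LBINT t:{-1<..<1}. (c + kernel_primitive a \<delta> t) *
        indicator {0..\<delta>} (sqrt (2 * (1 - t)))) = 2 * pi * ((c - G t0) * (2 * Z) - M t0)" for c
  proof -
    have "(LBINT t:{-1<..<1}. (c + kernel_primitive a \<delta> t) * indicator {0..\<delta>} (sqrt (2 * (1 - t))))
        = (LBINT t:{t0<..<1}. c + (G t - G t0))"
      unfolding set_lebesgue_integral_def
    proof (rule integral_discrete_difference[where X = "{t0}"])
      fix x :: real assume "x \<notin> {t0}"
      then show "indicat_real {-1<..<1} x *\<^sub>R ((c + kernel_primitive a \<delta> x) *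
            indicat_real {0..\<delta>} (sqrt (2 * (1 - x))))
          = indicat_real {t0<..<1} x *\<^sub>R (c + (G x - G t0))"
        using kernel_support[OF d(1), of x] prim[of x] t0(2)
        by (auto simp: indicator_def[of "{-1<..<1}"] indicator_def[of "{t0<..<1}"] t0_def)
    qed auto
    also have "\<dots> = c * (2 * Z) + (LBINT t:{t0<..<1}. G t - G t0)"
      using I t0 by (subst set_integral_add) (auto simp: set_lebesgue_integral_def set_integrable_def)
    also have "\<dots> = (c - G t0) * (2 * Z) - M t0"
      unfolding I(2) M1 using t0(1) by (simp only:) (simp add: algebra_simps)
    finally show ?thesis by simp
  qed
  have const: "kernel_const a \<delta> = G t0 + (1 / (2 * pi) + M t0) / (2 * Z)"
    unfolding kernel_const_def norm
    by (rule the_equality) (use Z in \<open>auto simp: field_simps\<close>)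
  show ?thesis
  proof (cases "t0 \<le> t")
    case True
    have p: "kernel_const a \<delta> + kernel_primitive a \<delta> t = G t + (1 / (2 * pi) + M t0) / (2 * Z)"
      using const prim[OF True t(2)] by simp
    have 1: "1 / (2 * pi) / (2 * Z) = 1 / (2 * pi) * (2 / \<delta>\<^sup>2)" by (simp add: Z_def)
    have 2: "M t0 / (2 * Z) = 1 / a * K * (2 / (2 + a) * F2 Z)"
    proof -
      have "2 / (2 + a) = 1 / (b + 1)" using b by (simp add: ab field_simps)
      then show ?thesis using Z b unfolding Mt0 by simp
    qed
    have 3: "G t = - (1 / a * K * ((2 * (1 - t) / \<delta>\<^sup>2) powr b * F1 ((1 - t) / 2)))"
    proof -
      have "2 * (1 - t) / \<delta>\<^sup>2 = ((1 - t) / 2) / Z" by (simp add: Z_def divide_simps)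
      then show ?thesis using Z t by (simp only: powr_divide G_def) (simp add: powr_divide)
    qed
    have "b + 1 = (2 + a) / 2" "b + 2 = (4 + a) / 2" by (auto simp: b_def)
    then show ?thesis
      unfolding kernel_def p add_divide_distrib 1 2 3 F1_def F2_def
      by (simp add: K_def Z_def b_def algebra_simps)
  next
    case False
    then show ?thesis using kernel_support[OF d(1), of t] t by (simp add: kernel_def t0_def)
  qed
qed


lemma continuous_on_legendre_P: "continuous_on S (legendre_P n)"
  by (induction n rule: induct_nat_012) (auto intro!: continuous_intros)

lemma classical_part_of_Theta_vanishes:
  assumes a: "-1 < a" "a < 1"
  shows "((\<lambda>\<delta>. funk_hecke l (\<lambda>t. (1 - t) * kernel_deriv a \<delta> t)) \<longlongrightarrow> 0) (at_right 0)"
proof -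
  have "bounded (legendre_P l ` {-1..1})"
    by (intro compact_imp_bounded compact_continuous_image continuous_on_legendre_P) auto
  then obtain B where B: "0 < B" "\<And>t. t \<in> {-1..1} \<Longrightarrow> \<bar>legendre_P l t\<bar> \<le> B"
    by (auto simp: bounded_pos)
  define C where "C = B * (sqrt ((1 + a) / pi) * 2 powr (a / 2))"
  have C: "0 < C" using a B by (auto simp: C_def)
  define D where "D = 2 * pi * C / (a / 2 + 1) / 2 powr (a / 2 + 1)"
  have bound: "\<bar>funk_hecke l (\<lambda>t. (1 - t) * kernel_deriv a \<delta> t)\<bar> \<le> D * \<delta>"
    if d: "0 < \<delta>" "\<delta> < 1" for \<delta>
  proof -
    define t0 where "t0 = 1 - \<delta>\<^sup>2 / 2"
    have "\<delta> * \<delta> < 1 * 1" using d by (intro mult_strict_mono) auto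
    then have t0: "0 < t0" "t0 < 1" using d by (auto simp: t0_def power2_eq_square)
    define g where "g t = C / \<delta> powr (1 + a) * (1 - t) powr (a / 2)" for t
    define H where "H t = - (C / \<delta> powr (1 + a) / (a / 2 + 1)) * (1 - t) powr (a / 2 + 1)" for t
    have "continuous_on {t0..1} H"
      unfolding H_def using a by (intro continuous_intros continuous_on_powr') auto
    moreover have "(H has_real_derivative g x) (at x)" if "t0 < x" "x < 1" for x
    proof -
      have b: "a / 2 + 1 \<noteq> 0" using a by simp
      have "((\<lambda>t. (1 - t) powr (a / 2 + 1)) has_real_derivative
          (a / 2 + 1) * (1 - x) powr (a / 2 + 1 - 1) * (- 1)) (at x)"
        by (rule DERIV_chain2[where f = "\<lambda>y. y powr (a / 2 + 1)"])
           (use that in \<open>auto intro!: derivative_eq_intros has_real_derivative_powr\<close>)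
      from DERIV_cmult[OF this, of "- (C / \<delta> powr (1 + a) / (a / 2 + 1))"]
      have *: "(H has_real_derivative - (C / \<delta> powr (1 + a) / (a / 2 + 1)) *
          ((a / 2 + 1) * (1 - x) powr (a / 2 + 1 - 1) * (- 1))) (at x)"
        unfolding H_def .
      have "- (A / k) * (k * Y * (- 1)) = A * Y" if "k \<noteq> 0" for A k Y :: real
        using that by simp
      from *[unfolded this[OF b]] show ?thesis unfolding g_def by simp
    qed
    moreover have "isCont g x" if "t0 < x" "x < 1" for x
      unfolding g_def using that by (intro continuous_intros) auto
    moreover have "0 \<le> g x" if "t0 < x" "x < 1" for x
      using C d by (auto simp: g_def)
    ultimately have I: "set_integrable lborel {t0<..<1} g" "(LBINT x:{t0<..<1}. g x) = H 1 - H t0"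
      using FTC_nonneg_Icc[OF t0(2), of H g] by auto
    have ptw: "norm (indicat_real {-1<..<1} t *\<^sub>R (legendre_P l t * ((1 - t) * kernel_deriv a \<delta> t)))
        \<le> indicat_real {t0<..<1} t *\<^sub>R g t" if "t \<noteq> t0" for t
    proof (cases "t0 < t \<and> t < 1")
      case True
      then have t: "0 < t" "t < 1" using t0 by auto
      have "indicator {0..\<delta>} (sqrt (2 * (1 - t))) = (1::real)"
        using kernel_support[of \<delta> t] d True by (simp add: t0_def)
      then have k: "(1 - t) * kernel_deriv a \<delta> t = sqrt ((1 + a) / pi) * 2 powr (a / 2) / \<delta> powr (1 + a) *
          ((1 - t) / (1 - t) powr ((2 - a) / 2)) * (1 / sqrt (1 + t))"
        by (simp add: kernel_deriv_def)
      have p: "(1 - t) / (1 - t) powr ((2 - a) / 2) = (1 - t) powr (a / 2)"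
      proof -
        have "(1 - t) / (1 - t) powr ((2 - a) / 2) = (1 - t) powr (1 - (2 - a) / 2)"
          using t by (simp only: powr_diff) simp
        also have "1 - (2 - a) / 2 = a / 2" by (simp add: field_simps)
        finally show ?thesis .
      qed
      define e where "e = sqrt ((1 + a) / pi) * 2 powr (a / 2) / \<delta> powr (1 + a) * (1 - t) powr (a / 2)"
      have e: "0 \<le> e" using a by (simp add: e_def)
      have "(1 - t) * kernel_deriv a \<delta> t = e * (1 / sqrt (1 + t))"
        unfolding k p e_def ..
      moreover have "1 / sqrt (1 + t) \<le> 1" "0 \<le> 1 / sqrt (1 + t)" using t by auto
      ultimately have "\<bar>(1 - t) * kernel_deriv a \<delta> t\<bar> \<le> e"
        using mult_left_mono[OF _ e, of "1 / sqrt (1 + t)" 1] e by (simp add: abs_mult)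
      then have "\<bar>legendre_P l t * ((1 - t) * kernel_deriv a \<delta> t)\<bar> \<le> B * e"
        unfolding abs_mult[of "legendre_P l t"] using B t by (intro mult_mono) auto
      also have "B * e = g t" by (simp add: e_def g_def C_def)
      finally show ?thesis using True t0 by (simp add: indicator_def)
    next
      case False
      then show ?thesis using kernel_support[of \<delta> t] d that
        by (auto simp: indicator_def[of "{-1<..<1}"] indicator_def[of "{t0<..<1}"] kernel_deriv_def t0_def)
    qed
    have ae: "AE t in lborel. norm (indicat_real {-1<..<1} t *\<^sub>R (legendre_P l t * ((1 - t) * kernel_deriv a \<delta> t)))
        \<le> indicat_real {t0<..<1} t *\<^sub>R g t"
      using AE_lborel_singleton[of t0] by eventually_elim (rule ptw)
    have "norm (LBINT t:{-1<..<1}. legendre_P l t * ((1 - t) * kernel_deriv a \<delta> t)) \<le> (LBINT x:{t0<..<1}. g x)"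
      unfolding set_lebesgue_integral_def
    proof (cases "integrable lborel (\<lambda>t. indicat_real {-1<..<1} t *\<^sub>R (legendre_P l t * ((1 - t) * kernel_deriv a \<delta> t)))")
      case True
      then show "norm (LBINT t. indicat_real {-1<..<1} t *\<^sub>R (legendre_P l t * ((1 - t) * kernel_deriv a \<delta> t)))
          \<le> (LBINT x. indicat_real {t0<..<1} x *\<^sub>R g x)"
        using I(1) ae unfolding set_integrable_def
        by (intro order_trans[OF integral_norm_bound integral_mono_AE] integrable_norm)
    next
      case False
      then show "norm (LBINT t. indicat_real {-1<..<1} t *\<^sub>R (legendre_P l t * ((1 - t) * kernel_deriv a \<delta> t)))
          \<le> (LBINT x. indicat_real {t0<..<1} x *\<^sub>R g x)"
        using C d by (auto simp: not_integrable_integral_eq g_def intro!: Bochner_Integration.integral_nonneg)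
    qed
    also have "\<dots> = C / \<delta> powr (1 + a) / (a / 2 + 1) * (\<delta>\<^sup>2 / 2) powr (a / 2 + 1)"
      unfolding I(2) H_def using a by (simp add: t0_def)
    also have "(\<delta>\<^sup>2 / 2) powr (a / 2 + 1) = \<delta> * \<delta> powr (1 + a) / 2 powr (a / 2 + 1)"
    proof -
      have "(\<delta>\<^sup>2) powr (a / 2 + 1) = (\<delta> powr 2) powr (a / 2 + 1)" using d by simp
      also have "\<dots> = \<delta> powr (1 + (1 + a))" unfolding powr_powr by (simp add: algebra_simps)
      also have "\<dots> = \<delta> * \<delta> powr (1 + a)" using d by (subst powr_add) simp
      finally show ?thesis by (simp add: powr_divide)
    qed
    also have "C / \<delta> powr (1 + a) / (a / 2 + 1) * (\<delta> * \<delta> powr (1 + a) / 2 powr (a / 2 + 1))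
        = C / (a / 2 + 1) / 2 powr (a / 2 + 1) * \<delta>"
      using d by simp
    finally have "2 * pi * \<bar>LBINT t:{-1<..<1}. legendre_P l t * ((1 - t) * kernel_deriv a \<delta> t)\<bar>
        \<le> 2 * pi * (C / (a / 2 + 1) / 2 powr (a / 2 + 1) * \<delta>)"
      unfolding real_norm_def by (intro mult_left_mono) auto
    then show ?thesis by (simp only: funk_hecke_def D_def abs_mult) simp
  qed
  show ?thesis
  proof (rule Lim_null_comparison)
    show "\<forall>\<^sub>F \<delta> in at_right 0. norm (funk_hecke l (\<lambda>t. (1 - t) * kernel_deriv a \<delta> t)) \<le> D * \<delta>"
      using eventually_at_right_real[of 0 1] by (auto elim!: eventually_mono intro!: bound)
    have "((\<lambda>\<delta>. D * \<delta>) \<longlongrightarrow> D * 0) (at_right 0)" by (intro tendsto_intros)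
    then show "((\<lambda>\<delta>. D * \<delta>) \<longlongrightarrow> 0) (at_right 0)" by simp
  qed
qed

end

theory Submission
  imports Defs
begin

text \<open>Every operator acts diagonally in the expansion, up to the orders of the norms, so the claim
  is dominated convergence for the coefficient sums: the multipliers must be bounded uniformly in
  the degree and converge for each degree. For the bound, \<open>\<bar>P\<^sub>l\<bar> \<le> 1\<close> on \<open>[-1, 1]\<close>, because
  \<open>P\<^sub>l(cos \<phi>)\<close> is a combination of the numbers \<open>cis ((2 k - l) \<phi>)\<close> with nonnegative coefficients that sum
  to \<open>P\<^sub>l(1) = 1\<close>. Exchanging the order of integration gives
  \<open>\<integral> kernel = \<delta>\<^sup>2/2 \<cdot> kernel_const + \<integral> (1 - t) kernel_deriv\<close>; the last term vanishes with \<open>\<delta>\<close>. Hence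
  for small \<open>\<delta>\<close> the kernel is a probability density concentrating at \<open>t = 1\<close>, and the point mass
  in \<open>Theta\<close> carries asymptotically the whole unit mass, so that both \<open>Lam\<close> and \<open>Theta\<close> are
  bounded by \<open>1\<close> and tend to \<open>P\<^sub>l(1) = 1\<close>.\<close>

section \<open>Legendre polynomials\<close>

definition half_coeff_fps :: "complex \<Rightarrow> complex fps" where
  "half_coeff_fps w = Abs_fps (\<lambda>n. of_real (half_coeff n) * w ^ n)"

text \<open>\<open>half_coeff_fps w\<close> is \<open>(1 - w X)\<^sup>-\<^sup>1\<^sup>/\<^sup>2\<close>; for \<open>w v = 1\<close> and \<open>w + v = 2 t\<close> the product of two such
  series is the generating function \<open>(1 - 2 t X + X\<^sup>2)\<^sup>-\<^sup>1\<^sup>/\<^sup>2\<close> of the Legendre polynomials.\<close>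

lemma half_coeff_fps_deriv:
  "(1 - fps_const w * fps_X) * fps_deriv (half_coeff_fps w) = fps_const (w / 2) * half_coeff_fps w"
proof (rule fps_ext)
  fix n
  have S: "of_real (half_coeff (Suc n)) * (2 * of_nat n + 2 :: complex)
      = of_real (half_coeff n) * (2 * of_nat n + 1)"
  proof -
    have "half_coeff (Suc n) * (2 * real n + 2) = half_coeff n * (2 * real n + 1)"
      unfolding half_coeff_Suc by simp
    from arg_cong[OF this, of complex_of_real] show ?thesis by simp
  qed
  \<comment> \<open>Multiplication by \<open>fps_X\<close> shifts the index, so degree 0 is split
    off; there the subtracted term is 0 because of its factor \<open>of_nat n\<close>.\<close>
  have "fps_nth ((1 - fps_const w * fps_X) * fps_deriv (half_coeff_fps w)) n
      = of_nat (Suc n) * (of_real (half_coeff (Suc n)) * w ^ Suc n)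
        - w * (of_nat n * (of_real (half_coeff n) * w ^ n))"
    by (cases n) (simp_all add: half_coeff_fps_def left_diff_distrib mult.assoc)
  also have "\<dots> = w * w ^ n * (of_real (half_coeff (Suc n)) * (2 * of_nat n + 2) / 2
      - of_nat n * of_real (half_coeff n))"
    by (simp add: algebra_simps)
  also have "\<dots> = fps_nth (fps_const (w / 2) * half_coeff_fps w) n"
    unfolding S by (simp add: half_coeff_fps_def algebra_simps)
  finally show "fps_nth ((1 - fps_const w * fps_X) * fps_deriv (half_coeff_fps w)) n
      = fps_nth (fps_const (w / 2) * half_coeff_fps w) n" .
qed

text \<open>The differential equations of the two factors combine into
  \<open>(1 - 2 t X + X^2) f' = (t - X) f\<close> for the product \<open>f\<close>, and comparing
  coefficients gives the recursion that defines \<open>legendre_P\<close>. The factorisation makes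
  the coefficients explicit as convolutions.\<close>

lemma fps_nth_half_coeff_fps_mult:
  assumes wv: "w * v = 1" "w + v = of_real (2 * t)"
  shows "fps_nth (half_coeff_fps w * half_coeff_fps v) n = of_real (legendre_P n t)"
proof -
  define f where "f = half_coeff_fps w * half_coeff_fps v"
  \<comment> \<open>Product rule, with each derivative placed next to its own linear factor so that
    \<open>half_coeff_fps_deriv\<close> applies.\<close>
  have "(1 - fps_const w * fps_X) * (1 - fps_const v * fps_X) * fps_deriv f
     = ((1 - fps_const w * fps_X) * fps_deriv (half_coeff_fps w)) * ((1 - fps_const v * fps_X) * half_coeff_fps v)
     + ((1 - fps_const v * fps_X) * fps_deriv (half_coeff_fps v)) * ((1 - fps_const w * fps_X) * half_coeff_fps w)"
    unfolding f_def by (simp only: fps_deriv_mult) (simp only: algebra_simps)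
  also have "\<dots> = (fps_const (w / 2) * (1 - fps_const v * fps_X) + fps_const (v / 2) * (1 - fps_const w * fps_X)) * f"
    unfolding half_coeff_fps_deriv f_def by (simp only: algebra_simps)
  also have "fps_const (w / 2) * (1 - fps_const v * fps_X) + fps_const (v / 2) * (1 - fps_const w * fps_X)
     = fps_const ((w + v) / 2) - fps_const (w * v) * fps_X"
    by (rule fps_ext) (auto simp: algebra_simps fps_X_def field_simps)
  also have "(1 - fps_const w * fps_X) * (1 - fps_const v * fps_X)
     = 1 - fps_const (w + v) * fps_X + fps_const (w * v) * (fps_X * fps_X)"
    by (simp add: algebra_simps flip: fps_const_add fps_const_mult)
  finally have "(1 - fps_const (of_real (2 * t)) * fps_X + fps_X * fps_X) * fps_deriv f
      = (fps_const (of_real t) - fps_X) * f"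
    unfolding wv by simp
  then have ode: "fps_nth (fps_deriv f) n - of_real (2 * t) * fps_nth (fps_X * fps_deriv f) n
      + fps_nth (fps_X * (fps_X * fps_deriv f)) n
      = of_real t * fps_nth f n - fps_nth (fps_X * f) n" for n
    by (drule_tac arg_cong[of _ _ "\<lambda>g. fps_nth g n"])
       (simp only: distrib_right left_diff_distrib fps_sub_nth fps_add_nth mult.assoc
          fps_mult_left_const_nth mult_1_left)
  have "fps_nth f n = of_real (legendre_P n t)"
  proof (induction n rule: induct_nat_012)
    case 0
    show ?case by (simp add: f_def half_coeff_fps_def half_coeff_def)
  next
    case 1
    show ?case using ode[of 0] by (simp add: f_def half_coeff_fps_def half_coeff_def)
  next
    case (ge2 n)
    \<comment> \<open>At index \<open>Suc n\<close> the equation reads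
      \<open>(n+2) f_(n+2) - 2 t (n+1) f_(n+1) + n f_n = t f_(n+1) - f_n\<close>; the double shift
      makes \<open>n = 0\<close> a separate case.\<close>
    have "(of_nat n + 2) * fps_nth f (Suc (Suc n))
        = (2 * of_nat n + 3) * of_real t * fps_nth f (Suc n) - (of_nat n + 1) * fps_nth f n"
      using ode[of "Suc n"] by (cases n) (simp_all add: algebra_simps)
    moreover have "(of_nat n + 2 :: complex) \<noteq> 0"
      by (metis of_nat_0_eq_iff of_nat_add of_nat_numeral add_is_0 zero_neq_numeral)
    ultimately show ?case
      unfolding ge2 by (simp add: field_simps)
  qed
  then show ?thesis by (simp add: f_def)
qed

lemma legendre_P_1 [simp]: "legendre_P n 1 = 1"
  by (induction n rule: induct_nat_012) (auto simp: field_simps)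

lemma abs_legendre_P_le_1:
  assumes "\<bar>t\<bar> \<le> 1"
  shows "\<bar>legendre_P n t\<bar> \<le> 1"
proof -
  \<comment> \<open>Conjugate points of the unit circle with real part \<open>t\<close>; all their
    powers have modulus 1.\<close>
  define w v where "w = cis (arccos t)" and "v = cis (- arccos t)"
  have "w * v = 1" by (simp add: w_def v_def cis_mult)
  moreover have "w + v = of_real (2 * t)"
    using assms by (simp add: w_def v_def complex_eq_iff cos_arccos_abs)
  ultimately have "\<bar>legendre_P n t\<bar> = cmod (fps_nth (half_coeff_fps w * half_coeff_fps v) n)"
    by (subst fps_nth_half_coeff_fps_mult) auto
  also have "\<dots> \<le> (\<Sum>i=0..n. half_coeff i * half_coeff (n - i))"
    unfolding fps_mult_nth half_coeff_fps_def
    by (intro sum_norm_le)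
       (simp add: norm_mult norm_power w_def v_def half_coeff_pos less_imp_le)
  also have "\<dots> = 1"
  proof -
    have "of_real (\<Sum>i=0..n. half_coeff i * half_coeff (n - i)) = fps_nth (half_coeff_fps 1 * half_coeff_fps 1) n"
      by (simp add: fps_mult_nth half_coeff_fps_def)
    \<comment> \<open>For \<open>t = 1\<close> the pair is \<open>w = v = 1\<close>.\<close>
    also have "\<dots> = of_real (legendre_P n 1)"
      by (rule fps_nth_half_coeff_fps_mult) auto
    finally show ?thesis by (simp only: of_real_eq_iff legendre_P_1)
  qed
  finally show ?thesis .
qed

section \<open>The kernel and its multipliers\<close>

lemma kernel_deriv_nonneg:
  assumes "-1 < a" "-1 \<le> t"
  shows "0 \<le> kernel_deriv a \<delta> t"
  using assms unfolding kernel_deriv_def by (intro mult_nonneg_nonneg) auto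

lemma borel_measurable_kernel_deriv [measurable]: "kernel_deriv a \<delta> \<in> borel_measurable borel"
  unfolding kernel_deriv_def[abs_def] by measurable

text \<open>The factor \<open>1 - t\<close> raises the exponent at the singularity
  \<open>t = 1\<close> from \<open>a/2 - 1\<close>, which is not integrable for
  \<open>a \<le> 0\<close>, to \<open>a/2 > -1/2\<close>. The other singular factor
  \<open>1 / sqrt (1 + t)\<close> stays bounded because \<open>\<delta> < 2\<close> keeps the
  support away from -1.\<close>

lemma kernel_deriv_moment_integrable:
  assumes a: "-1 < a" "a < 1" and d: "0 < \<delta>" "\<delta> < 2"
  shows "set_integrable lborel {1 - \<delta>\<^sup>2 / 2..<1} (\<lambda>t. (1 - t) * kernel_deriv a \<delta> t)"
proof -
  define t0 where "t0 = 1 - \<delta>\<^sup>2 / 2"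
  have "\<delta> * \<delta> < 2 * 2" using d by (intro mult_strict_mono) auto
  then have t0: "-1 < t0" "t0 < 1" using d by (auto simp: t0_def power2_eq_square)
  define H where "H t = - ((1 - t) powr (a / 2 + 1)) / (a / 2 + 1)" for t :: real
  have b: "0 < a / 2 + 1" using a by simp
  have H_int: "set_integrable lborel {t0<..<1} (\<lambda>t. (1 - t) powr (a / 2))"
  proof (rule FTC_nonneg_Icc)
    show "continuous_on {t0..1} H"
      unfolding H_def using b by (intro continuous_intros continuous_on_powr') auto
    show "(H has_real_derivative (1 - x) powr (a / 2)) (at x)" if "t0 < x" "x < 1" for x
    proof -
      have "((\<lambda>t. (1 - t) powr (a / 2 + 1)) has_real_derivative
          (a / 2 + 1) * (1 - x) powr (a / 2 + 1 - 1) * (- 1)) (at x)"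
        by (rule DERIV_chain2[where f = "\<lambda>y. y powr (a / 2 + 1)"])
           (use that in \<open>auto intro!: derivative_eq_intros has_real_derivative_powr\<close>)
      from DERIV_cdivide[OF DERIV_minus[OF this], of "a / 2 + 1"] show ?thesis
        unfolding H_def using b by simp
    qed
    show "isCont (\<lambda>t. (1 - t) powr (a / 2)) x" if "t0 < x" "x < 1" for x
      using that by (intro continuous_intros) auto
  qed (use t0 in auto)
  \<comment> \<open>The constants of \<open>kernel_deriv\<close> times the largest value of
    \<open>1 / sqrt (1 + t)\<close> on the support, attained at the cut-off.\<close>
  define C where "C = sqrt ((1 + a) / pi) * (2 powr (a / 2) / \<delta> powr (1 + a)) / sqrt (1 + t0)"
  have "set_integrable lborel {t0<..<1} (\<lambda>t. C * (1 - t) powr (a / 2))"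
    by (intro set_integrable_mult_right H_int)
  then have I: "integrable lborel (\<lambda>t. indicator {t0<..<1} t *\<^sub>R (C * (1 - t) powr (a / 2)))"
    by (simp add: set_integrable_def)
  \<comment> \<open>At \<open>t0\<close> the left side is positive and the majorant, living on the
    open interval, is 0; this point is discarded as a null set.\<close>
  have ptw: "norm (indicator {t0..<1} t *\<^sub>R ((1 - t) * kernel_deriv a \<delta> t))
      \<le> norm (indicator {t0<..<1} t *\<^sub>R (C * (1 - t) powr (a / 2)))" if "t \<noteq> t0" for t
  proof (cases "t0 < t \<and> t < 1")
    case True
    have p: "(1 - t) * (1 / (1 - t) powr ((2 - a) / 2)) = (1 - t) powr (a / 2)"
    proof -
      have "(1 - t) / (1 - t) powr ((2 - a) / 2) = (1 - t) powr (1 - (2 - a) / 2)"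
        using True by (simp only: powr_diff) simp
      also have "1 - (2 - a) / 2 = a / 2" by (simp add: field_simps)
      finally show ?thesis by simp
    qed
    have "(1 - t) * kernel_deriv a \<delta> t
        = sqrt ((1 + a) / pi) * (2 powr (a / 2) / \<delta> powr (1 + a)) * (1 / sqrt (1 + t))
          * indicator {0..\<delta>} (sqrt (2 * (1 - t))) * ((1 - t) * (1 / (1 - t) powr ((2 - a) / 2)))"
      by (simp add: kernel_deriv_def mult_ac)
    also have "\<dots> \<le> sqrt ((1 + a) / pi) * (2 powr (a / 2) / \<delta> powr (1 + a)) * (1 / sqrt (1 + t0))
          * 1 * (1 - t) powr (a / 2)"
      unfolding p using True t0 a d
      by (intro mult_mono mult_nonneg_nonneg divide_left_mono) (auto simp: indicator_def)
    also have "\<dots> = C * (1 - t) powr (a / 2)" by (simp add: C_def)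
    finally have "(1 - t) * kernel_deriv a \<delta> t \<le> C * (1 - t) powr (a / 2)" .
    moreover have "0 \<le> (1 - t) * kernel_deriv a \<delta> t"
      using True t0 a by (intro mult_nonneg_nonneg kernel_deriv_nonneg) auto
    ultimately show ?thesis using True by (simp add: indicator_def)
  qed (use that in \<open>auto simp: indicator_def\<close>)
  have "AE t in lborel. norm (indicator {t0..<1} t *\<^sub>R ((1 - t) * kernel_deriv a \<delta> t))
      \<le> norm (indicator {t0<..<1} t *\<^sub>R (C * (1 - t) powr (a / 2)))"
    using AE_lborel_singleton[of t0] by eventually_elim (rule ptw)
  then show ?thesis
    unfolding set_integrable_def t0_def[symmetric]
    by (rule Bochner_Integration.integrable_bound[OF I, rotated]) measurable
qed

lemma kernel_primitive_nonneg:
  assumes "-1 < a" "0 < \<delta>" "\<delta> < 2"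
  shows "0 \<le> kernel_primitive a \<delta> t"
proof -
  have "\<delta> * \<delta> < 2 * 2" using assms by (intro mult_strict_mono) auto
  then show ?thesis
    unfolding kernel_primitive_def set_lebesgue_integral_def using assms
    by (intro Bochner_Integration.integral_nonneg)
       (auto simp: indicator_def power2_eq_square intro!: kernel_deriv_nonneg)
qed

text \<open>Fubini on the triangle \<open>t0 \<le> x \<le> t < 1\<close>: integrating over
  \<open>t\<close> first leaves the length \<open>1 - x\<close>. This also settles integrability
  when \<open>a \<le> 0\<close>, where the primitive is unbounded near 1.\<close>

lemma kernel_primitive_integral:
  assumes a: "-1 < a" "a < 1" and d: "0 < \<delta>" "\<delta> < 2"
  defines "t0 \<equiv> 1 - \<delta>\<^sup>2 / 2"
  shows "set_integrable lborel {t0<..<1} (kernel_primitive a \<delta>)"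
    and "(LBINT t:{t0<..<1}. kernel_primitive a \<delta> t) = (LBINT t:{t0..<1}. (1 - t) * kernel_deriv a \<delta> t)"
proof -
  have "\<delta> * \<delta> < 2 * 2" using d by (intro mult_strict_mono) auto
  then have t0: "-1 < t0" "t0 < 1" using d by (auto simp: t0_def power2_eq_square)
  define f where "f = (\<lambda>(x, t). indicat_real {t0..<1} x * (indicat_real {x..<1} t * kernel_deriv a \<delta> x))"
  have f_inner: "(\<integral>t. f (x, t) \<partial>lborel) = indicat_real {t0..<1} x *\<^sub>R ((1 - x) * kernel_deriv a \<delta> x)"
    for x by (auto simp: f_def indicator_def[of "{t0..<1}"])
  have f_nn: "norm (f z) = f z" for z
    using a t0 by (auto simp: f_def indicator_def split: prod.splits intro!: abs_of_nonneg kernel_deriv_nonneg)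
  have [measurable]: "f \<in> borel_measurable (lborel \<Otimes>\<^sub>M lborel)"
  proof -
    have "f = (\<lambda>z. if t0 \<le> fst z \<and> fst z < 1 \<and> fst z \<le> snd z \<and> snd z < 1 then kernel_deriv a \<delta> (fst z) else 0)"
      by (auto simp: f_def indicator_def fun_eq_iff)
    then show ?thesis by simp
  qed
  \<comment> \<open>Since \<open>f\<close> is nonnegative, the iterated integral of its norm is the
    moment of \<open>kernel_deriv_moment_integrable\<close>.\<close>
  have int: "integrable (lborel \<Otimes>\<^sub>M lborel) f"
  proof (rule lborel_pair.Fubini_integrable)
    show "integrable lborel (\<lambda>x. \<integral>y. norm (f (x, y)) \<partial>lborel)"
      unfolding f_nn f_inner
      using kernel_deriv_moment_integrable[OF a d] by (simp add: set_integrable_def t0_def)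
    show "AE x in lborel. integrable lborel (\<lambda>y. f (x, y))"
    proof (rule AE_I2)
      fix x
      show "integrable lborel (\<lambda>y. f (x, y))"
      proof (cases "t0 \<le> x \<and> x < 1")
        case True
        then show ?thesis
          unfolding f_def by (auto intro!: integrable_mult_right integrable_mult_left integrable_real_indicator)
      next
        case False
        then show ?thesis by (auto simp: f_def indicator_def[of "{t0..<1}"])
      qed
    qed
  qed measurable
  have f_outer: "(\<integral>x. f (x, t) \<partial>lborel) = indicat_real {t0<..<1} t *\<^sub>R kernel_primitive a \<delta> t"
    if "t \<noteq> t0" for t
  proof (cases "t0 < t \<and> t < 1")
    case True
    then show ?thesis
      unfolding kernel_primitive_def set_lebesgue_integral_def t0_def[symmetric]
      by (auto simp: f_def indicator_def intro!: Bochner_Integration.integral_cong)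
  next
    case False
    then have "f (x, t) = 0" for x using that by (auto simp: f_def indicator_def)
    then show ?thesis using False by (simp add: indicator_def)
  qed
  have ae: "AE t in lborel. (\<integral>x. f (x, t) \<partial>lborel) = indicat_real {t0<..<1} t *\<^sub>R kernel_primitive a \<delta> t"
    using AE_lborel_singleton[of t0] by eventually_elim (rule f_outer)
  have i2: "integrable lborel (\<lambda>t. \<integral>x. f (x, t) \<partial>lborel)"
    using lborel_pair.integrable_snd[of "\<lambda>x t. f (x, t)"] int by (simp add: case_prod_eta)
  \<comment> \<open>The primitive inherits measurability from the section integral of Fubini, with
    which it agrees off one point.\<close>
  have bm: "(\<lambda>t. indicat_real {t0<..<1} t *\<^sub>R kernel_primitive a \<delta> t) \<in> borel_measurable lborel"
  proof -
    have "(\<lambda>t. indicat_real {t0<..<1} t *\<^sub>R kernel_primitive a \<delta> t)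
        = (\<lambda>t. if t = t0 then 0 else \<integral>x. f (x, t) \<partial>lborel)"
      using f_outer by (auto simp: indicator_def)
    then show ?thesis using borel_measurable_integrable[OF i2] by simp
  qed
  show "set_integrable lborel {t0<..<1} (kernel_primitive a \<delta>)"
    unfolding set_integrable_def
    using integrable_cong_AE[OF borel_measurable_integrable[OF i2] bm ae] i2 by simp
  have "(LBINT t:{t0<..<1}. kernel_primitive a \<delta> t) = (\<integral>t. \<integral>x. f (x, t) \<partial>lborel \<partial>lborel)"
    unfolding set_lebesgue_integral_def
    by (rule integral_cong_AE[OF bm borel_measurable_integrable[OF i2]])
       (use ae in eventually_elim, simp)
  also have "\<dots> = (\<integral>x. \<integral>t. f (x, t) \<partial>lborel \<partial>lborel)"
    using lborel_pair.Fubini_integral[of "\<lambda>x t. f (x, t)"] int by (simp add: case_prod_eta)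
  also have "\<dots> = (LBINT t:{t0..<1}. (1 - t) * kernel_deriv a \<delta> t)"
    unfolding f_inner set_lebesgue_integral_def ..
  finally show "(LBINT t:{t0<..<1}. kernel_primitive a \<delta> t)
      = (LBINT t:{t0..<1}. (1 - t) * kernel_deriv a \<delta> t)" .
qed

section \<open>Normalisation and sign of the kernel\<close>

lemma kernel_eq:
  assumes "0 < \<delta>" "t \<le> 1"
  shows "kernel a \<delta> t = (if 1 - \<delta>\<^sup>2 / 2 \<le> t then kernel_const a \<delta> + kernel_primitive a \<delta> t else 0)"
  using kernel_support[OF assms] by (simp add: kernel_def)

lemma funk_hecke_kernel_deriv:
  assumes d: "0 < \<delta>" "\<delta> < 2"
  shows "funk_hecke l (\<lambda>t. (1 - t) * kernel_deriv a \<delta> t)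
      = 2 * pi * (LBINT t:{1 - \<delta>\<^sup>2 / 2..<1}. legendre_P l t * ((1 - t) * kernel_deriv a \<delta> t))"
proof -
  \<comment> \<open>The cut-off lies above -1, so \<open>{-1<..<1}\<close> can be shrunk to the
    support.\<close>
  have "\<delta> * \<delta> < 2 * 2" using d by (intro mult_strict_mono) auto
  then have "indicat_real {-1<..<1} t *\<^sub>R (legendre_P l t * ((1 - t) * kernel_deriv a \<delta> t))
      = indicat_real {1 - \<delta>\<^sup>2 / 2..<1} t *\<^sub>R (legendre_P l t * ((1 - t) * kernel_deriv a \<delta> t))" for t
    using kernel_support[OF d(1), of t]
    by (auto simp: kernel_deriv_def power2_eq_square indicator_def[of "{-1<..<1}"]
        indicator_def[of "{1 - \<delta>\<^sup>2 / 2..<1}"])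
  then show ?thesis by (simp only: funk_hecke_def set_lebesgue_integral_def)
qed

text \<open>The normalisation integral as a function of the unknown constant: the support has length
  \<delta>^2/2, which gives the slope, and the primitive contributes the moment. An arbitrary
  \<open>c\<close> is kept so that the formula can be rewritten under the description operator in
  \<open>kernel_const\<close>.\<close>

lemma affine_primitive_integral:
  assumes a: "-1 < a" "a < 1" and d: "0 < \<delta>" "\<delta> < 2"
  shows "set_integrable lborel {-1<..<1}
      (\<lambda>t. (c + kernel_primitive a \<delta> t) * indicator {0..\<delta>} (sqrt (2 * (1 - t))))"
    and "2 * pi * (LBINT t:{-1<..<1}.
        (c + kernel_primitive a \<delta> t) * indicator {0..\<delta>} (sqrt (2 * (1 - t))))
      = 2 * pi * (\<delta>\<^sup>2 / 2) * c + funk_hecke 0 (\<lambda>t. (1 - t) * kernel_deriv a \<delta> t)"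
proof -
  define t0 where "t0 = 1 - \<delta>\<^sup>2 / 2"
  have "\<delta> * \<delta> < 2 * 2" using d by (intro mult_strict_mono) auto
  then have t0: "-1 < t0" "t0 < 1" using d by (auto simp: t0_def power2_eq_square)
  note prim = kernel_primitive_integral[OF a d, folded t0_def]
  have const: "set_integrable lborel {t0<..<1} (\<lambda>t. c)"
    using t0 unfolding set_integrable_def
    by (intro integrable_scaleR_left integrable_real_indicator) auto
  have eq: "indicat_real {-1<..<1} t *\<^sub>R ((c + kernel_primitive a \<delta> t) * indicator {0..\<delta>} (sqrt (2 * (1 - t))))
      = indicat_real {t0<..<1} t *\<^sub>R (c + kernel_primitive a \<delta> t)" if "t \<notin> {t0}" for t
    using kernel_support[OF d(1), of t] t0 that
    by (auto simp: indicator_def[of "{-1<..<1}"] indicator_def[of "{t0<..<1}"] t0_def)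
  show "set_integrable lborel {-1<..<1}
      (\<lambda>t. (c + kernel_primitive a \<delta> t) * indicator {0..\<delta>} (sqrt (2 * (1 - t))))"
    using set_integral_add(1)[OF const prim(1)]
      integrable_discrete_difference[of "{t0}" lborel, OF _ _ _ eq]
    unfolding set_integrable_def by auto
  have "(LBINT t:{-1<..<1}. (c + kernel_primitive a \<delta> t) * indicator {0..\<delta>} (sqrt (2 * (1 - t))))
      = (LBINT t:{t0<..<1}. c + kernel_primitive a \<delta> t)"
    unfolding set_lebesgue_integral_def
    by (rule integral_discrete_difference[of "{t0}" lborel, OF _ _ _ eq]) auto
  also have "\<dots> = (\<delta>\<^sup>2 / 2) * c + (LBINT t:{t0..<1}. (1 - t) * kernel_deriv a \<delta> t)"
    using set_integral_add(2)[OF const prim(1)] prim(2) t0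
    by (simp add: set_lebesgue_integral_def t0_def)
  finally show "2 * pi * (LBINT t:{-1<..<1}.
        (c + kernel_primitive a \<delta> t) * indicator {0..\<delta>} (sqrt (2 * (1 - t))))
      = 2 * pi * (\<delta>\<^sup>2 / 2) * c + funk_hecke 0 (\<lambda>t. (1 - t) * kernel_deriv a \<delta> t)"
    using funk_hecke_kernel_deriv[OF d, of 0 a] by (simp add: t0_def algebra_simps)
qed

text \<open>The affine equation for the constant has positive slope, hence exactly one solution, and
  the description operator picks it.\<close>

lemma kernel_const_eq:
  assumes a: "-1 < a" "a < 1" and d: "0 < \<delta>" "\<delta> < 2"
  shows "2 * pi * (\<delta>\<^sup>2 / 2) * kernel_const a \<delta>
      = 1 - funk_hecke 0 (\<lambda>t. (1 - t) * kernel_deriv a \<delta> t)"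
proof -
  have "kernel_const a \<delta>
      = (1 - funk_hecke 0 (\<lambda>t. (1 - t) * kernel_deriv a \<delta> t)) / (2 * pi * (\<delta>\<^sup>2 / 2))"
    unfolding kernel_const_def affine_primitive_integral(2)[OF assms]
    by (rule the_equality) (use d in \<open>auto simp: field_simps\<close>)
  then show ?thesis using d by simp
qed

lemma kernel_integrable:
  assumes "-1 < a" "a < 1" "0 < \<delta>" "\<delta> < 2"
  shows "set_integrable lborel {-1<..<1} (kernel a \<delta>)"
  using affine_primitive_integral(1)[OF assms] by (simp add: kernel_def[abs_def])

lemma kernel_integral:
  assumes "-1 < a" "a < 1" "0 < \<delta>" "\<delta> < 2"
  shows "2 * pi * (LBINT t:{-1<..<1}. kernel a \<delta> t) = 1"
  using affine_primitive_integral(2)[OF assms] kernel_const_eq[OF assms]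
  by (simp add: kernel_def[abs_def])

text \<open>By \<open>kernel_const_eq\<close>, \<open>m\<close> expresses nonnegativity of the
  constant; the primitive added to it on the support is nonnegative anyway.\<close>

lemma kernel_nonneg:
  assumes a: "-1 < a" "a < 1" and d: "0 < \<delta>" "\<delta> < 2" and t: "t \<le> 1"
    and m: "funk_hecke 0 (\<lambda>t. (1 - t) * kernel_deriv a \<delta> t) \<le> 1"
  shows "0 \<le> kernel a \<delta> t"
proof -
  have "0 \<le> 2 * pi * (\<delta>\<^sup>2 / 2) * kernel_const a \<delta>"
    using kernel_const_eq[OF a d] m by simp
  moreover have "0 < 2 * pi * (\<delta>\<^sup>2 / 2)" using d by simp
  ultimately have "0 \<le> kernel_const a \<delta>" by (metis mult_less_0_iff not_le)
  then show ?thesis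
    using kernel_eq[OF d(1) t] kernel_primitive_nonneg[OF a(1) d] by simp
qed

section \<open>Uniform bounds and limits of the multipliers\<close>

lemma abs_integral_le:
  fixes f g :: "'a \<Rightarrow> real"
  assumes "integrable M g" "\<And>x. \<bar>f x\<bar> \<le> g x"
  shows "\<bar>\<integral>x. f x \<partial>M\<bar> \<le> (\<integral>x. g x \<partial>M)"
proof -
  \<comment> \<open>If \<open>f\<close> is not integrable, its integral is 0 by convention and the
    bound persists, since \<open>g\<close> dominates an absolute value.\<close>
  have "\<bar>\<integral>x. f x \<partial>M\<bar> \<le> (\<integral>x. \<bar>f x\<bar> \<partial>M)"
    using integral_norm_bound[of M f] by simp
  also have "\<dots> \<le> (\<integral>x. g x \<partial>M)"
    using assms order_trans[OF abs_ge_zero assms(2)] by (intro integral_mono')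
  finally show ?thesis .
qed

text \<open>Under \<open>m\<close> the kernel is a probability density with respect to
  \<open>2 * pi\<close> times Lebesgue measure, so \<open>Lam a \<delta> l - c\<close> is the mean
  of \<open>legendre_P l - c\<close> over the support. With \<open>c = 0\<close> this yields the
  uniform bound, with \<open>c = 1\<close> the limit.\<close>

lemma abs_Lam_diff_le:
  assumes a: "-1 < a" "a < 1" and d: "0 < \<delta>" "\<delta> < 2"
    and m: "funk_hecke 0 (\<lambda>t. (1 - t) * kernel_deriv a \<delta> t) \<le> 1"
    and c: "\<And>t. -1 < t \<Longrightarrow> 1 - \<delta>\<^sup>2 / 2 \<le> t \<Longrightarrow> t < 1 \<Longrightarrow> \<bar>legendre_P l t - c\<bar> \<le> e"
  shows "\<bar>Lam a \<delta> l - c\<bar> \<le> e"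
proof -
  note K = kernel_integrable[OF a d]
  have [measurable]: "legendre_P l \<in> borel_measurable borel"
    by (intro borel_measurable_continuous_onI continuous_on_legendre_P)
  have P: "set_integrable lborel {-1<..<1} (\<lambda>t. legendre_P l t * kernel a \<delta> t)"
    unfolding set_integrable_def
  proof (rule Bochner_Integration.integrable_bound[OF K[unfolded set_integrable_def]])
    have "(\<lambda>t. legendre_P l t * (indicat_real {-1<..<1} t *\<^sub>R kernel a \<delta> t)) \<in> borel_measurable lborel"
      using borel_measurable_integrable[OF K[unfolded set_integrable_def]] by measurable
    then show "(\<lambda>t. indicat_real {-1<..<1} t *\<^sub>R (legendre_P l t * kernel a \<delta> t)) \<in> borel_measurable lborel"
      by (simp add: mult_ac)
    show "AE t in lborel. norm (indicat_real {-1<..<1} t *\<^sub>R (legendre_P l t * kernel a \<delta> t))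
        \<le> norm (indicat_real {-1<..<1} t *\<^sub>R kernel a \<delta> t)"
      by (auto simp: indicator_def abs_mult intro!: mult_left_le_one_le abs_legendre_P_le_1)
  qed
  have cK: "set_integrable lborel {-1<..<1} (\<lambda>t. c * kernel a \<delta> t)"
    by (intro set_integrable_mult_right K)
  have eK: "set_integrable lborel {-1<..<1} (\<lambda>t. e * kernel a \<delta> t)"
    by (intro set_integrable_mult_right K)
  note D = set_integral_diff[OF P cK]
  have "\<bar>LBINT t:{-1<..<1}. legendre_P l t * kernel a \<delta> t - c * kernel a \<delta> t\<bar>
      \<le> (LBINT t:{-1<..<1}. e * kernel a \<delta> t)"
    unfolding set_lebesgue_integral_def
  proof (rule abs_integral_le)
    fix t :: real
    have "\<bar>legendre_P l t * kernel a \<delta> t - c * kernel a \<delta> t\<bar> \<le> e * kernel a \<delta> t" if t: "-1 < t" "t < 1"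
    proof (cases "1 - \<delta>\<^sup>2 / 2 \<le> t")
      case True
      have nn: "0 \<le> kernel a \<delta> t" using kernel_nonneg[OF a d _ m] t by simp
      have "\<bar>legendre_P l t * kernel a \<delta> t - c * kernel a \<delta> t\<bar> = \<bar>legendre_P l t - c\<bar> * kernel a \<delta> t"
        using nn by (simp flip: left_diff_distrib add: abs_mult)
      also have "\<dots> \<le> e * kernel a \<delta> t" using c True t nn by (intro mult_right_mono) auto
      finally show ?thesis .
    qed (use t kernel_eq[OF d(1), of t] in simp)
    then show "\<bar>indicat_real {-1<..<1} t *\<^sub>R (legendre_P l t * kernel a \<delta> t - c * kernel a \<delta> t)\<bar>
        \<le> indicat_real {-1<..<1} t *\<^sub>R (e * kernel a \<delta> t)"
      by (simp add: indicator_def)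
  qed (use eK in \<open>simp add: set_integrable_def\<close>)
  then have le: "2 * pi * \<bar>(LBINT t:{-1<..<1}. legendre_P l t * kernel a \<delta> t) - c * (LBINT t:{-1<..<1}. kernel a \<delta> t)\<bar>
      \<le> e * (2 * pi * (LBINT t:{-1<..<1}. kernel a \<delta> t))"
    unfolding D(2) set_integral_mult_right by simp
  have "Lam a \<delta> l - c = 2 * pi * ((LBINT t:{-1<..<1}. legendre_P l t * kernel a \<delta> t)
      - c * (LBINT t:{-1<..<1}. kernel a \<delta> t))"
    using kernel_integral[OF a d] unfolding Lam_def funk_hecke_def right_diff_distrib
    by (simp add: mult_ac)
  then have "\<bar>Lam a \<delta> l - c\<bar> = 2 * pi * \<bar>(LBINT t:{-1<..<1}. legendre_P l t * kernel a \<delta> t)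
      - c * (LBINT t:{-1<..<1}. kernel a \<delta> t)\<bar>" by (simp add: abs_mult)
  then show ?thesis using le unfolding kernel_integral[OF a d] by simp
qed

text \<open>At the cut-off the primitive vanishes, so the jump is \<open>kernel_const\<close>, and
  the normalisation turns the weight of the point mass into 1 minus the mass of the classical part.
  Thus \<open>Theta\<close> integrates \<open>legendre_P l\<close> against total mass 1.\<close>

lemma Theta_eq:
  assumes a: "-1 < a" "a < 1" and d: "0 < \<delta>" "\<delta> < 2"
  shows "Theta a \<delta> l = funk_hecke l (\<lambda>t. (1 - t) * kernel_deriv a \<delta> t)
     + legendre_P l (1 - \<delta>\<^sup>2 / 2) * (1 - funk_hecke 0 (\<lambda>t. (1 - t) * kernel_deriv a \<delta> t))"
proof -
  \<comment> \<open>The integral runs over a single point.\<close>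
  have "kernel_primitive a \<delta> (1 - \<delta>\<^sup>2 / 2) = 0"
    unfolding kernel_primitive_def set_lebesgue_integral_def
    by (subst integral_discrete_difference[where X = "{1 - \<delta>\<^sup>2 / 2}" and g = "\<lambda>_. 0"]) auto
  then have "kernel_jump a \<delta> = kernel_const a \<delta>"
    using d kernel_eq[OF d(1)] by (simp add: kernel_jump_def)
  then show ?thesis
    unfolding Theta_def kernel_const_eq[OF a d, symmetric] by (simp add: mult_ac)
qed

lemma Theta_0: "-1 < a \<Longrightarrow> a < 1 \<Longrightarrow> 0 < \<delta> \<Longrightarrow> \<delta> < 2 \<Longrightarrow> Theta a \<delta> 0 = 1"
  by (subst Theta_eq) auto

text \<open>In \<open>Theta_eq\<close> the classical part has mass \<open>funk_hecke 0\<close>, the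
  point mass has the complementary one, and \<open>m\<close> makes the latter nonnegative; so
  \<open>Theta\<close> is an average of values of \<open>legendre_P l\<close>.\<close>

lemma abs_Theta_le_1:
  assumes a: "-1 < a" "a < 1" and d: "0 < \<delta>" "\<delta> < 2"
    and m: "funk_hecke 0 (\<lambda>t. (1 - t) * kernel_deriv a \<delta> t) \<le> 1"
  shows "\<bar>Theta a \<delta> l\<bar> \<le> 1"
proof -
  have "\<delta> * \<delta> < 2 * 2" using d by (intro mult_strict_mono) auto
  then have t0: "-1 < 1 - \<delta>\<^sup>2 / 2" by (simp add: power2_eq_square)
  note I = kernel_deriv_moment_integrable[OF a d]
  have "\<bar>LBINT t:{1 - \<delta>\<^sup>2 / 2..<1}. legendre_P l t * ((1 - t) * kernel_deriv a \<delta> t)\<bar>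
      \<le> (LBINT t:{1 - \<delta>\<^sup>2 / 2..<1}. (1 - t) * kernel_deriv a \<delta> t)"
    unfolding set_lebesgue_integral_def
  proof (rule abs_integral_le)
    show "integrable lborel (\<lambda>t. indicat_real {1 - \<delta>\<^sup>2 / 2..<1} t *\<^sub>R ((1 - t) * kernel_deriv a \<delta> t))"
      using I by (simp add: set_integrable_def)
    fix t :: real
    have "0 \<le> kernel_deriv a \<delta> t \<and> \<bar>legendre_P l t\<bar> \<le> 1" if "1 - \<delta>\<^sup>2 / 2 \<le> t" "t < 1"
      using that t0 a by (auto intro!: kernel_deriv_nonneg abs_legendre_P_le_1)
    then show "\<bar>indicat_real {1 - \<delta>\<^sup>2 / 2..<1} t *\<^sub>R (legendre_P l t * ((1 - t) * kernel_deriv a \<delta> t))\<bar>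
        \<le> indicat_real {1 - \<delta>\<^sup>2 / 2..<1} t *\<^sub>R ((1 - t) * kernel_deriv a \<delta> t)"
      by (auto simp: indicator_def abs_mult intro!: mult_left_le_one_le)
  qed
  then have "\<bar>funk_hecke l (\<lambda>t. (1 - t) * kernel_deriv a \<delta> t)\<bar>
      \<le> funk_hecke 0 (\<lambda>t. (1 - t) * kernel_deriv a \<delta> t)"
    unfolding funk_hecke_kernel_deriv[OF d] by (simp add: abs_mult)
  moreover have "\<bar>legendre_P l (1 - \<delta>\<^sup>2 / 2) * (1 - funk_hecke 0 (\<lambda>t. (1 - t) * kernel_deriv a \<delta> t))\<bar>
      \<le> 1 - funk_hecke 0 (\<lambda>t. (1 - t) * kernel_deriv a \<delta> t)"
    unfolding abs_mult using t0 m
    by (subst abs_of_nonneg[of "1 - funk_hecke 0 _"])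
       (auto intro!: mult_left_le_one_le abs_legendre_P_le_1 simp: abs_le_iff)
  ultimately show ?thesis unfolding Theta_eq[OF a d] by linarith
qed

lemma tendsto_Theta:
  assumes a: "-1 < a" "a < 1"
  shows "((\<lambda>\<delta>. Theta a \<delta> l) \<longlongrightarrow> 1) (at_right 0)"
proof (rule Lim_transform_eventually)
  note M = classical_part_of_Theta_vanishes[OF a]
  have "((\<lambda>\<delta>. legendre_P l (1 - \<delta>\<^sup>2 / 2)) \<longlongrightarrow> legendre_P l (1 - 0\<^sup>2 / 2)) (at_right 0)"
    by (intro isCont_tendsto_compose[where g = "legendre_P l"] tendsto_intros
        continuous_on_interior[OF continuous_on_legendre_P[of UNIV]]) auto
  from tendsto_add[OF M[of l] tendsto_mult[OF this tendsto_diff[OF tendsto_const[of 1] M[of 0]]]]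
  show "((\<lambda>\<delta>. funk_hecke l (\<lambda>t. (1 - t) * kernel_deriv a \<delta> t) + legendre_P l (1 - \<delta>\<^sup>2 / 2) *
      (1 - funk_hecke 0 (\<lambda>t. (1 - t) * kernel_deriv a \<delta> t))) \<longlongrightarrow> 1) (at_right 0)"
    by simp
  show "\<forall>\<^sub>F \<delta> in at_right 0. funk_hecke l (\<lambda>t. (1 - t) * kernel_deriv a \<delta> t) + legendre_P l (1 - \<delta>\<^sup>2 / 2) *
      (1 - funk_hecke 0 (\<lambda>t. (1 - t) * kernel_deriv a \<delta> t)) = Theta a \<delta> l"
    using eventually_at_right_real[of 0 2] by (rule eventually_mono) (auto simp: Theta_eq[OF a])
qed

text \<open>The range of \<delta> in which the kernel is a probability density: a moment above 1
  would make \<open>kernel_const\<close>, the value at the cut-off, negative.\<close>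

lemma eventually_small_horizon:
  assumes a: "-1 < a" "a < 1"
  shows "\<forall>\<^sub>F \<delta> in at_right 0. 0 < \<delta> \<and> \<delta> < 2 \<and>
    funk_hecke 0 (\<lambda>t. (1 - t) * kernel_deriv a \<delta> t) \<le> 1"
proof -
  have "\<forall>\<^sub>F \<delta> in at_right 0. funk_hecke 0 (\<lambda>t. (1 - t) * kernel_deriv a \<delta> t) < 1"
    using order_tendstoD(2)[OF classical_part_of_Theta_vanishes[OF a, of 0], of 1] by simp
  moreover have "\<forall>\<^sub>F \<delta>::real in at_right 0. \<delta> \<in> {0<..<2}"
    by (rule eventually_at_right_real) simp
  ultimately show ?thesis by eventually_elim auto
qed

lemma tendsto_Lam:
  assumes a: "-1 < a" "a < 1"
  shows "((\<lambda>\<delta>. Lam a \<delta> l) \<longlongrightarrow> 1) (at_right 0)"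
proof (rule tendstoI)
  fix e :: real assume "0 < e"
  have "isCont (legendre_P l) 1"
    by (rule continuous_on_interior[OF continuous_on_legendre_P[of UNIV]]) simp
  then obtain r where r: "0 < r" "\<And>t. \<bar>t - 1\<bar> < r \<Longrightarrow> \<bar>legendre_P l t - 1\<bar> < e / 2"
    using \<open>0 < e\<close> unfolding continuous_at_eps_delta dist_real_def legendre_P_1
    by (metis half_gt_zero)
  \<comment> \<open>Once the length \<delta>^2/2 of the support is below \<open>r\<close>, the whole
    support is \<open>r\<close>-close to 1. The bound \<open>e / 2\<close> absorbs the passage from
    a weak to a strict inequality.\<close>
  have "((\<lambda>\<delta>::real. \<delta>\<^sup>2 / 2) \<longlongrightarrow> 0\<^sup>2 / 2) (at_right 0)" by (intro tendsto_intros) auto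
  then have "\<forall>\<^sub>F \<delta> in at_right 0. \<delta>\<^sup>2 / 2 < r" using r(1) by (auto dest: order_tendstoD)
  with eventually_small_horizon[OF a]
  show "\<forall>\<^sub>F \<delta> in at_right 0. dist (Lam a \<delta> l) 1 < e"
  proof eventually_elim
    case (elim \<delta>)
    then have "\<bar>Lam a \<delta> l - 1\<bar> \<le> e / 2"
      by (intro abs_Lam_diff_le[OF a] less_imp_le[OF r(2)]) auto
    then show ?case using \<open>0 < e\<close> by (simp add: dist_real_def)
  qed
qed

section \<open>Dominated convergence of expansions\<close>

text \<open>By the M-test the finite partial sums converge uniformly on \<open>S\<close>, so the
  limit in \<open>y\<close> may be exchanged with the limit over finite index sets.\<close>

lemma infsum_dominated_tendsto:
  fixes f :: "'a \<Rightarrow> 'b::t2_space \<Rightarrow> real"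
  assumes q: "q summable_on A"
    and le: "\<And>x y. x \<in> A \<Longrightarrow> y \<in> S \<Longrightarrow> \<bar>f x y\<bar> \<le> q x"
    and lim: "\<And>x. x \<in> A \<Longrightarrow> (f x \<longlongrightarrow> 0) (at y0 within S)"
  shows "((\<lambda>y. \<Sum>\<^sub>\<infinity>x\<in>A. f x y) \<longlongrightarrow> 0) (at y0 within S)"
proof (rule swap_uniform_limit)
  show "uniform_limit S (\<lambda>X y. \<Sum>x\<in>X. f x y) (\<lambda>y. \<Sum>\<^sub>\<infinity>x\<in>A. f x y) (finite_subsets_at_top A)"
    by (rule Weierstrass_m_test_general[OF _ q]) (use le in auto)
  show "\<forall>\<^sub>F X in finite_subsets_at_top A. ((\<lambda>y. \<Sum>x\<in>X. f x y) \<longlongrightarrow> 0) (at y0 within S)"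
  proof (rule eventually_finite_subsets_at_top_weakI)
    fix X assume "finite X" "X \<subseteq> A"
    then have "((\<lambda>y. \<Sum>x\<in>X. f x y) \<longlongrightarrow> (\<Sum>x\<in>X. 0)) (at y0 within S)"
      by (intro tendsto_sum lim) auto
    then show "((\<lambda>y. \<Sum>x\<in>X. f x y) \<longlongrightarrow> 0) (at y0 within S)" by simp
  qed
qed auto

lemma ell2_norm_finite_iff: "ell2_norm q < \<infinity> \<longleftrightarrow> (\<lambda>(l, m). q l m) summable_on modes"
  by (simp add: ell2_norm_def)

lemma ell2_norm_tendsto_0:
  assumes q: "ell2_norm q < \<infinity>"
    and le: "\<forall>\<^sub>F \<delta> in at_right (0::real). \<forall>l m. 0 \<le> f \<delta> l m \<and> f \<delta> l m \<le> C * q l m"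
    and lim: "\<And>l m. ((\<lambda>\<delta>. f \<delta> l m) \<longlongrightarrow> 0) (at_right 0)"
  shows "((\<lambda>\<delta>. ell2_norm (f \<delta>)) \<longlongrightarrow> 0) (at_right 0)"
proof -
  define Q where "Q = (\<lambda>(l, m). C * q l m)"
  have Q: "Q summable_on modes"
    using summable_on_cmult_right[of "\<lambda>(l, m). q l m" modes C] q
    unfolding ell2_norm_finite_iff Q_def case_prod_unfold by simp
  obtain d where "0 < d" and
    d: "\<And>\<delta> l m. 0 < \<delta> \<Longrightarrow> \<delta> < d \<Longrightarrow> 0 \<le> f \<delta> l m \<and> f \<delta> l m \<le> C * q l m"
    using le unfolding eventually_at_right_field by auto
  \<comment> \<open>The M-test asks for domination on a whole set; the filter is restricted to an
    interval where it holds.\<close>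
  have S: "at_right 0 = at 0 within {0<..<d}"
    using \<open>0 < d\<close> by (intro at_within_nhd[of _ "{..<d}"]) auto
  have "((\<lambda>\<delta>. \<Sum>\<^sub>\<infinity>x\<in>modes. f \<delta> (fst x) (snd x)) \<longlongrightarrow> 0) (at_right 0)"
    unfolding S
    by (rule infsum_dominated_tendsto[OF Q])
       (use d lim in \<open>auto simp: Q_def S[symmetric] split: prod.splits\<close>)
  then have "((\<lambda>\<delta>. ennreal (sqrt (\<Sum>\<^sub>\<infinity>x\<in>modes. f \<delta> (fst x) (snd x)))) \<longlongrightarrow> ennreal (sqrt 0)) (at_right 0)"
    by (intro tendsto_ennrealI tendsto_real_sqrt)
  \<comment> \<open>Domination excludes the infinite branch of \<open>ell2_norm\<close> for small
    \<delta>.\<close>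
  moreover have "\<forall>\<^sub>F \<delta> in at_right 0. ennreal (sqrt (\<Sum>\<^sub>\<infinity>x\<in>modes. f \<delta> (fst x) (snd x))) = ell2_norm (f \<delta>)"
    using le
  proof eventually_elim
    case (elim \<delta>)
    have "(\<lambda>(l, m). f \<delta> l m) summable_on modes"
      by (rule summable_on_comparison_test[OF Q]) (use elim in \<open>auto simp: Q_def\<close>)
    then show ?case by (simp add: ell2_norm_def case_prod_unfold)
  qed
  ultimately show ?thesis by (auto intro: Lim_transform_eventually)
qed

section \<open>Comparison of Sobolev weights and convergence in the three norms\<close>

lemma ll1_weight_le:
  "(real l + 1/2) powr (2 * (s - 1)) * (cmod (ll1 l))\<^sup>2 \<le> (real l + 1/2) powr (2 * s + 2)"
proof -
  have "cmod (ll1 l) = real (l * (l + 1))" unfolding ll1_def by (rule norm_of_nat)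
  \<comment> \<open>\<open>l (l + 1)\<close> is \<open>(l + 1/2)^2 - 1/4\<close>. Its square thus
    raises the exponent \<open>2 (s - 1)\<close> by 4, to the weight of \<open>Vs\<close> and
    \<open>Vt\<close> in order \<open>s\<close>.\<close>
  also have "\<dots> \<le> (real l + 1/2)\<^sup>2" by (simp add: power2_eq_square algebra_simps)
  finally have "(cmod (ll1 l))\<^sup>2 \<le> ((real l + 1/2)\<^sup>2)\<^sup>2" by (intro power_mono) auto
  also have "\<dots> = (real l + 1/2) powr 4" by (simp add: powr_numeral)
  finally have "(real l + 1/2) powr (2 * (s - 1)) * (cmod (ll1 l))\<^sup>2
      \<le> (real l + 1/2) powr (2 * (s - 1)) * (real l + 1/2) powr 4"
    by (intro mult_left_mono) auto
  also have "\<dots> = (real l + 1/2) powr (2 * s + 2)"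
    unfolding powr_add[symmetric] by (simp add: add.commute)
  finally show ?thesis .
qed

text \<open>The constant 4 comes from degree 0, where \<open>(l + 1/2)^2 = 1/4\<close>.\<close>

lemma weight_le_4:
  "(real l + 1/2) powr (2 * s) \<le> 4 * (real l + 1/2) powr (2 * s + 2)"
proof -
  have "(1/2)\<^sup>2 \<le> (real l + 1/2)\<^sup>2" by (intro power_mono) auto
  then have "1 * (real l + 1/2) powr (2 * s) \<le> (4 * (real l + 1/2)\<^sup>2) * (real l + 1/2) powr (2 * s)"
    by (intro mult_right_mono) (auto simp: power2_eq_square)
  also have "\<dots> = 4 * (real l + 1/2) powr (2 * s + 2)"
    by (simp add: powr_add)
  finally show ?thesis by simp
qed

text \<open>Serves the divergence with \<open>v = - Vs\<close> and the surface curl with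
  \<open>v = Vt\<close>; \<gamma> is the deviation of the multiplier from its limit.\<close>

lemma scalar_norm_tendsto_0:
  assumes V: "vector_norm s (Vs, Vt, Vx) < \<infinity>"
    and v: "\<And>l m. (cmod (v l m))\<^sup>2 \<le> (cmod (Vs l m))\<^sup>2 + (cmod (Vt l m))\<^sup>2"
    and le: "\<forall>\<^sub>F \<delta> in at_right (0::real). \<forall>l. \<bar>\<gamma> \<delta> l\<bar> \<le> (K::real)"
    and lim: "\<And>l. ((\<lambda>\<delta>. \<gamma> \<delta> l) \<longlongrightarrow> 0) (at_right 0)"
  shows "((\<lambda>\<delta>. scalar_norm (s - 1) (\<lambda>l m. of_real (\<gamma> \<delta> l) * ll1 l * v l m)) \<longlongrightarrow> 0) (at_right 0)"
  unfolding scalar_norm_def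
proof (rule ell2_norm_tendsto_0[OF V[unfolded vector_norm_def prod.case]])
  show "\<forall>\<^sub>F \<delta> in at_right 0. \<forall>l m.
      0 \<le> (real l + 1/2) powr (2 * (s - 1)) * (cmod (of_real (\<gamma> \<delta> l) * ll1 l * v l m))\<^sup>2 \<and>
      (real l + 1/2) powr (2 * (s - 1)) * (cmod (of_real (\<gamma> \<delta> l) * ll1 l * v l m))\<^sup>2
      \<le> K\<^sup>2 * ((real l + 1/2) powr (2 * s + 2) * ((cmod (Vs l m))\<^sup>2 + (cmod (Vt l m))\<^sup>2)
         + (real l + 1/2) powr (2 * s) * (cmod (Vx l m))\<^sup>2)"
    using le
  proof (eventually_elim, intro allI conjI)
    fix \<delta> l m assume "\<forall>l. \<bar>\<gamma> \<delta> l\<bar> \<le> K"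
    then have "\<bar>\<gamma> \<delta> l\<bar>\<^sup>2 \<le> K\<^sup>2" by (intro power_mono) auto
    then have g: "(\<gamma> \<delta> l)\<^sup>2 \<le> K\<^sup>2" by simp
    have "(real l + 1/2) powr (2 * (s - 1)) * (cmod (of_real (\<gamma> \<delta> l) * ll1 l * v l m))\<^sup>2
        = (\<gamma> \<delta> l)\<^sup>2 * (((real l + 1/2) powr (2 * (s - 1)) * (cmod (ll1 l))\<^sup>2) * (cmod (v l m))\<^sup>2)"
      by (simp add: norm_mult power_mult_distrib mult_ac)
    also have "\<dots> \<le> K\<^sup>2 * ((real l + 1/2) powr (2 * s + 2) * ((cmod (Vs l m))\<^sup>2 + (cmod (Vt l m))\<^sup>2))"
      by (intro mult_mono g ll1_weight_le v) auto
    also have "\<dots> \<le> K\<^sup>2 * ((real l + 1/2) powr (2 * s + 2) * ((cmod (Vs l m))\<^sup>2 + (cmod (Vt l m))\<^sup>2)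
         + (real l + 1/2) powr (2 * s) * (cmod (Vx l m))\<^sup>2)"
      by (intro mult_left_mono) auto
    finally show "(real l + 1/2) powr (2 * (s - 1)) * (cmod (of_real (\<gamma> \<delta> l) * ll1 l * v l m))\<^sup>2 \<le> \<dots>" .
  qed simp
  fix l m
  have "((\<lambda>\<delta>. (real l + 1/2) powr (2 * (s - 1)) * (cmod (of_real (\<gamma> \<delta> l) * ll1 l * v l m))\<^sup>2) \<longlongrightarrow>
      (real l + 1/2) powr (2 * (s - 1)) * (cmod (of_real 0 * ll1 l * v l m))\<^sup>2) (at_right 0)"
    by (intro tendsto_intros lim)
  then show "((\<lambda>\<delta>. (real l + 1/2) powr (2 * (s - 1)) * (cmod (of_real (\<gamma> \<delta> l) * ll1 l * v l m))\<^sup>2) \<longlongrightarrow> 0)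
      (at_right 0)" by simp
qed

text \<open>The tangential weight of order \<open>s - 1\<close> has exponent
  \<open>2 (s - 1) + 2 = 2 s\<close>, the scalar weight of \<open>u\<close>; only the multiplier has
  to be controlled.\<close>

lemma tangential_norm_tendsto_0:
  assumes u: "scalar_norm s u < \<infinity>"
    and le: "\<forall>\<^sub>F \<delta> in at_right (0::real). \<forall>l. \<bar>\<gamma> \<delta> l\<bar> \<le> (K::real)"
    and lim: "\<And>l. ((\<lambda>\<delta>. \<gamma> \<delta> l) \<longlongrightarrow> 0) (at_right 0)"
  shows "((\<lambda>\<delta>. tangential_norm (s - 1) (tang (\<lambda>l m. of_real (\<gamma> \<delta> l) * u l m), \<lambda>l m. 0)) \<longlongrightarrow> 0) (at_right 0)"
  unfolding tangential_norm_def prod.case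
proof (rule ell2_norm_tendsto_0[OF u[unfolded scalar_norm_def]])
  have w: "2 * (s - 1) + 2 = 2 * s" by simp
  show "\<forall>\<^sub>F \<delta> in at_right 0. \<forall>l m.
      0 \<le> (real l + 1/2) powr (2 * (s - 1) + 2) *
        ((cmod (tang (\<lambda>l m. of_real (\<gamma> \<delta> l) * u l m) l m))\<^sup>2 + (cmod 0)\<^sup>2) \<and>
      (real l + 1/2) powr (2 * (s - 1) + 2) *
        ((cmod (tang (\<lambda>l m. of_real (\<gamma> \<delta> l) * u l m) l m))\<^sup>2 + (cmod 0)\<^sup>2)
      \<le> K\<^sup>2 * ((real l + 1/2) powr (2 * s) * (cmod (u l m))\<^sup>2)"
    using le
  proof (eventually_elim, intro allI conjI)
    fix \<delta> l m assume "\<forall>l. \<bar>\<gamma> \<delta> l\<bar> \<le> K"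
    then have "\<bar>\<gamma> \<delta> l\<bar>\<^sup>2 \<le> K\<^sup>2" by (intro power_mono) auto
    then have g: "(\<gamma> \<delta> l)\<^sup>2 \<le> K\<^sup>2" by simp
    have "(cmod (tang (\<lambda>l m. of_real (\<gamma> \<delta> l) * u l m) l m))\<^sup>2 \<le> (\<gamma> \<delta> l)\<^sup>2 * (cmod (u l m))\<^sup>2"
      by (simp add: tang_def norm_mult power_mult_distrib)
    also have "\<dots> \<le> K\<^sup>2 * (cmod (u l m))\<^sup>2" by (intro mult_right_mono g) auto
    finally have "(real l + 1/2) powr (2 * s) * (cmod (tang (\<lambda>l m. of_real (\<gamma> \<delta> l) * u l m) l m))\<^sup>2
        \<le> (real l + 1/2) powr (2 * s) * (K\<^sup>2 * (cmod (u l m))\<^sup>2)"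
      by (intro mult_left_mono) auto
    then show "(real l + 1/2) powr (2 * (s - 1) + 2) *
        ((cmod (tang (\<lambda>l m. of_real (\<gamma> \<delta> l) * u l m) l m))\<^sup>2 + (cmod 0)\<^sup>2)
      \<le> K\<^sup>2 * ((real l + 1/2) powr (2 * s) * (cmod (u l m))\<^sup>2)"
      unfolding w by (simp add: mult_ac)
  qed simp
  fix l m
  have "((\<lambda>\<delta>. (cmod (tang (\<lambda>l m. of_real (\<gamma> \<delta> l) * u l m) l m))\<^sup>2) \<longlongrightarrow>
      (cmod (tang (\<lambda>l m. of_real 0 * u l m) l m))\<^sup>2) (at_right 0)"
    unfolding tang_def by (cases "l = 0") (auto intro!: tendsto_eq_intros lim)
  from tendsto_mult[OF tendsto_const[of "(real l + 1/2) powr (2 * (s - 1) + 2)"] this]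
  show "((\<lambda>\<delta>. (real l + 1/2) powr (2 * (s - 1) + 2) *
        ((cmod (tang (\<lambda>l m. of_real (\<gamma> \<delta> l) * u l m) l m))\<^sup>2 + (cmod 0)\<^sup>2)) \<longlongrightarrow> 0) (at_right 0)"
    by (simp add: tang_def)
qed

text \<open>The shape of \<open>W\<close> covers the curl and its adjoint, which differ by
  exchanging \<alpha> and \<beta>. The tangential outputs carry exponent \<open>2 s\<close>, which
  fits \<open>Vx\<close> exactly and is absorbed by the higher weight of \<open>Vs\<close> and
  \<open>Vt\<close>; the normal output is handled by \<open>ll1_weight_le\<close>.\<close>

lemma vector_norm_tendsto_0:
  assumes V: "vector_norm s (Vs, Vt, Vx) < \<infinity>"
    and le: "\<forall>\<^sub>F \<delta> in at_right (0::real). \<forall>l. \<bar>\<alpha> \<delta> l\<bar> \<le> K \<and> \<bar>\<beta> \<delta> l\<bar> \<le> K \<and> \<bar>\<gamma> \<delta> l\<bar> \<le> (K::real)"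
    and lim: "\<And>l. ((\<lambda>\<delta>. \<alpha> \<delta> l) \<longlongrightarrow> 0) (at_right 0)" "\<And>l. ((\<lambda>\<delta>. \<beta> \<delta> l) \<longlongrightarrow> 0) (at_right 0)"
      "\<And>l. ((\<lambda>\<delta>. \<gamma> \<delta> l) \<longlongrightarrow> 0) (at_right 0)"
  defines "W \<equiv> (\<lambda>\<delta>. (tang (\<lambda>l m. of_real (\<alpha> \<delta> l) * Vt l m),
      tang (\<lambda>l m. of_real (\<beta> \<delta> l) * Vs l m - of_real (\<gamma> \<delta> l) * Vx l m),
      \<lambda>l m. - (of_real (\<gamma> \<delta> l) * ll1 l * Vt l m)))"
  shows "((\<lambda>\<delta>. vector_norm (s - 1) (W \<delta>)) \<longlongrightarrow> 0) (at_right 0)"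
proof -
  define A where "A \<delta> l m = tang (\<lambda>l m. of_real (\<alpha> \<delta> l) * Vt l m) l m" for \<delta> l m
  define B where "B \<delta> l m = tang (\<lambda>l m. of_real (\<beta> \<delta> l) * Vs l m - of_real (\<gamma> \<delta> l) * Vx l m) l m" for \<delta> l m
  define G where "G \<delta> l m = - (of_real (\<gamma> \<delta> l) * ll1 l * Vt l m)" for \<delta> l m
  define w where "w l = real l + 1/2" for l
  have W: "W \<delta> = (A \<delta>, B \<delta>, G \<delta>)" for \<delta>
    by (simp add: W_def A_def B_def G_def fun_eq_iff)
  show ?thesis
    unfolding vector_norm_def W prod.case
  proof (rule ell2_norm_tendsto_0[OF V[unfolded vector_norm_def prod.case]], fold w_def)
    show "\<forall>\<^sub>F \<delta> in at_right 0. \<forall>l m.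
      0 \<le> w l powr (2 * (s - 1) + 2) * ((cmod (A \<delta> l m))\<^sup>2 + (cmod (B \<delta> l m))\<^sup>2)
         + w l powr (2 * (s - 1)) * (cmod (G \<delta> l m))\<^sup>2 \<and>
      w l powr (2 * (s - 1) + 2) * ((cmod (A \<delta> l m))\<^sup>2 + (cmod (B \<delta> l m))\<^sup>2)
         + w l powr (2 * (s - 1)) * (cmod (G \<delta> l m))\<^sup>2
      \<le> (9 * K\<^sup>2) * (w l powr (2 * s + 2) * ((cmod (Vs l m))\<^sup>2 + (cmod (Vt l m))\<^sup>2)
         + w l powr (2 * s) * (cmod (Vx l m))\<^sup>2)"
      using le
    proof (eventually_elim, intro allI conjI)
      fix \<delta> l m assume *: "\<forall>l. \<bar>\<alpha> \<delta> l\<bar> \<le> K \<and> \<bar>\<beta> \<delta> l\<bar> \<le> K \<and> \<bar>\<gamma> \<delta> l\<bar> \<le> K"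
      have sq: "(cmod (of_real c * z))\<^sup>2 \<le> K\<^sup>2 * (cmod z)\<^sup>2" if "\<bar>c\<bar> \<le> K" for c z
        using power_mono[of "\<bar>c\<bar> * cmod z" "K * cmod z" 2] that
        by (simp add: norm_mult power_mult_distrib mult_right_mono)
      have A: "(cmod (A \<delta> l m))\<^sup>2 \<le> K\<^sup>2 * (cmod (Vt l m))\<^sup>2"
        using sq[of "\<alpha> \<delta> l" "Vt l m"] * by (simp add: A_def tang_def)
      have B: "(cmod (B \<delta> l m))\<^sup>2 \<le> 2 * (K\<^sup>2 * (cmod (Vs l m))\<^sup>2) + 2 * (K\<^sup>2 * (cmod (Vx l m))\<^sup>2)"
      proof -
        define p r where "p = of_real (\<beta> \<delta> l) * Vs l m" and "r = of_real (\<gamma> \<delta> l) * Vx l m"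
        have "(cmod (B \<delta> l m))\<^sup>2 \<le> (cmod (p - r))\<^sup>2"
          by (simp add: B_def tang_def p_def r_def)
        also have "\<dots> \<le> (cmod p + cmod r)\<^sup>2"
          by (intro power_mono norm_triangle_ineq4) auto
        also have "\<dots> \<le> 2 * (cmod p)\<^sup>2 + 2 * (cmod r)\<^sup>2"
          using sum_squares_bound[of "cmod p" "cmod r"] by (simp add: power2_sum)
        also have "\<dots> \<le> 2 * (K\<^sup>2 * (cmod (Vs l m))\<^sup>2) + 2 * (K\<^sup>2 * (cmod (Vx l m))\<^sup>2)"
          unfolding p_def r_def using * by (intro add_mono mult_left_mono sq) auto
        finally show ?thesis .
      qed
      define b where "b = w l powr (2 * s)"
      define d where "d = w l powr (2 * s + 2)"
      have bd: "0 \<le> b" "0 \<le> d" "b \<le> 4 * d"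
        using weight_le_4[of l s] by (auto simp: b_def d_def w_def)
      have G: "w l powr (2 * (s - 1)) * (cmod (G \<delta> l m))\<^sup>2 \<le> d * (K\<^sup>2 * (cmod (Vt l m))\<^sup>2)"
      proof -
        have "w l powr (2 * (s - 1)) * (cmod (G \<delta> l m))\<^sup>2
            = (w l powr (2 * (s - 1)) * (cmod (ll1 l))\<^sup>2) * (cmod (of_real (\<gamma> \<delta> l) * Vt l m))\<^sup>2"
          by (simp add: G_def norm_mult power_mult_distrib mult_ac)
        also have "\<dots> \<le> d * (K\<^sup>2 * (cmod (Vt l m))\<^sup>2)"
          unfolding d_def w_def using * by (intro mult_mono ll1_weight_le sq) auto
        finally show ?thesis .
      qed
      define S T X where "S = K\<^sup>2 * (cmod (Vs l m))\<^sup>2" and "T = K\<^sup>2 * (cmod (Vt l m))\<^sup>2"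
        and "X = K\<^sup>2 * (cmod (Vx l m))\<^sup>2"
      have STX: "0 \<le> S" "0 \<le> T" "0 \<le> X" by (auto simp: S_def T_def X_def)
      have "w l powr (2 * (s - 1) + 2) * ((cmod (A \<delta> l m))\<^sup>2 + (cmod (B \<delta> l m))\<^sup>2)
         \<le> b * (T + (2 * S + 2 * X))"
      proof -
        have "2 * (s - 1) + 2 = 2 * s" by simp
        then show ?thesis
          unfolding b_def S_def T_def X_def using A B by (simp only:) (intro mult_left_mono add_mono, auto)
      qed
      \<comment> \<open>\<open>X\<close> is separated because it has only the weight
        \<open>b\<close> available, while \<open>S\<close> and \<open>T\<close> may pass to
        \<open>4 * d\<close>.\<close>
      also have "\<dots> = b * (T + 2 * S) + 2 * (b * X)" by (simp add: algebra_simps)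
      also have "\<dots> \<le> 4 * d * (T + 2 * S) + 2 * (b * X)"
        using bd STX by (intro add_mono mult_right_mono) auto
      finally have "w l powr (2 * (s - 1) + 2) * ((cmod (A \<delta> l m))\<^sup>2 + (cmod (B \<delta> l m))\<^sup>2)
          + w l powr (2 * (s - 1)) * (cmod (G \<delta> l m))\<^sup>2
          \<le> (4 * d * (T + 2 * S) + 2 * (b * X)) + d * T"
        using G unfolding T_def by (rule add_mono)
      also have "\<dots> = 5 * (d * T) + 8 * (d * S) + 2 * (b * X)" by (simp add: algebra_simps)
      \<comment> \<open>A common constant above the coefficients 5, 8 and 2.\<close>
      also have "\<dots> \<le> 9 * (d * T) + 9 * (d * S) + 9 * (b * X)"
        using bd STX by (intro add_mono mult_right_mono) auto
      also have "\<dots> = (9 * K\<^sup>2) * (w l powr (2 * s + 2) * ((cmod (Vs l m))\<^sup>2 + (cmod (Vt l m))\<^sup>2)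
         + w l powr (2 * s) * (cmod (Vx l m))\<^sup>2)"
        unfolding S_def T_def X_def b_def d_def by (simp add: algebra_simps)
      finally show "w l powr (2 * (s - 1) + 2) * ((cmod (A \<delta> l m))\<^sup>2 + (cmod (B \<delta> l m))\<^sup>2)
          + w l powr (2 * (s - 1)) * (cmod (G \<delta> l m))\<^sup>2 \<le> \<dots>" .
    qed simp
    fix l m
    have "((\<lambda>\<delta>. A \<delta> l m) \<longlongrightarrow> 0) (at_right 0)" "((\<lambda>\<delta>. B \<delta> l m) \<longlongrightarrow> 0) (at_right 0)"
      unfolding A_def B_def tang_def
      by (cases "l = 0"; auto intro!: tendsto_eq_intros lim)+
    moreover have "((\<lambda>\<delta>. G \<delta> l m) \<longlongrightarrow> 0) (at_right 0)"
      unfolding G_def by (auto intro!: tendsto_eq_intros lim)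
    ultimately have "((\<lambda>\<delta>. w l powr (2 * (s - 1) + 2) * ((cmod (A \<delta> l m))\<^sup>2 + (cmod (B \<delta> l m))\<^sup>2)
         + w l powr (2 * (s - 1)) * (cmod (G \<delta> l m))\<^sup>2) \<longlongrightarrow>
        w l powr (2 * (s - 1) + 2) * ((cmod 0)\<^sup>2 + (cmod 0)\<^sup>2)
         + w l powr (2 * (s - 1)) * (cmod 0)\<^sup>2) (at_right 0)"
      by (intro tendsto_intros)
    then show "((\<lambda>\<delta>. w l powr (2 * (s - 1) + 2) * ((cmod (A \<delta> l m))\<^sup>2 + (cmod (B \<delta> l m))\<^sup>2)
         + w l powr (2 * (s - 1)) * (cmod (G \<delta> l m))\<^sup>2) \<longlongrightarrow> 0) (at_right 0)" by simp
  qed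
qed

section \<open>Strong convergence of the six operators\<close>

theorem theorem4p1:
  fixes a s :: real and Y :: "nat \<Rightarrow> int \<Rightarrow> real^3 \<Rightarrow> complex"
  assumes "-1 < a" and "a < 1" and "0 \<le> s"
    and "orthonormal_spherical_harmonics Y"
  shows
    "(\<forall>V \<in> sobolev_vector Y s.
        ((\<lambda>\<delta>. scalar_norm (s - 1) (nonlocal_div a \<delta> V - local_div V)) \<longlongrightarrow> 0) (at_right 0)) \<and>
     (\<forall>V \<in> sobolev_vector Y s.
        ((\<lambda>\<delta>. scalar_norm (s - 1) (nonlocal_surface_curl a \<delta> V - local_surface_curl V)) \<longlongrightarrow> 0)
          (at_right 0)) \<and>
     (\<forall>u \<in> sobolev_scalar Y s.
        ((\<lambda>\<delta>. tangential_norm (s - 1) (nonlocal_grad a \<delta> u - local_grad u)) \<longlongrightarrow> 0)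
          (at_right 0)) \<and>
     (\<forall>u \<in> sobolev_scalar Y s.
        ((\<lambda>\<delta>. tangential_norm (s - 1) (nonlocal_rotated_grad a \<delta> u - local_rotated_grad u)) \<longlongrightarrow> 0)
          (at_right 0)) \<and>
     (\<forall>V \<in> sobolev_vector Y s.
        ((\<lambda>\<delta>. vector_norm (s - 1) (nonlocal_curl a \<delta> V - local_curl V)) \<longlongrightarrow> 0)
          (at_right 0)) \<and>
     (\<forall>V \<in> sobolev_vector Y s.
        ((\<lambda>\<delta>. vector_norm (s - 1) (nonlocal_curl_adj a \<delta> V - local_curl_adj V)) \<longlongrightarrow> 0)
          (at_right 0))"
proof -
  note a = assms(1,2)
  have bound: "\<forall>\<^sub>F \<delta> in at_right 0. \<forall>l. \<bar>Lam a \<delta> l\<bar> \<le> 1 \<and> \<bar>Theta a \<delta> l\<bar> \<le> 1"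
    using eventually_small_horizon[OF a]
  proof eventually_elim
    case (elim \<delta>)
    show ?case
    proof
      fix l
      have "\<bar>Lam a \<delta> l - 0\<bar> \<le> 1"
        by (rule abs_Lam_diff_le[OF a]) (use elim in \<open>auto intro!: abs_legendre_P_le_1\<close>)
      then show "\<bar>Lam a \<delta> l\<bar> \<le> 1 \<and> \<bar>Theta a \<delta> l\<bar> \<le> 1"
        using abs_Theta_le_1[OF a] elim by simp
    qed
  qed
  \<comment> \<open>The bound 4 is shared with \<alpha> and \<beta> below, which are sums of four
    terms of modulus at most 1.\<close>
  have Lam_le: "\<forall>\<^sub>F \<delta> in at_right (0::real). \<forall>l. \<bar>Lam a \<delta> l - 1\<bar> \<le> 4"
    using bound
  proof eventually_elim
    case (elim \<delta>)
    show ?case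
    proof
      fix l show "\<bar>Lam a \<delta> l - 1\<bar> \<le> 4" using elim[rule_format, of l] by linarith
    qed
  qed
  note lims = tendsto_Lam[OF a] tendsto_Theta[OF a]
  have Lam_lim: "((\<lambda>\<delta>. Lam a \<delta> l - 1) \<longlongrightarrow> 0) (at_right 0)" for l
    by (auto intro!: tendsto_eq_intros lims)
  \<comment> \<open>Deviations of the two tangential multipliers of the nonlocal curl from their
    local values -1 and 1.\<close>
  define \<alpha> \<beta> where "\<alpha> \<delta> l = - Theta a \<delta> 0 + Theta a \<delta> l - Lam a \<delta> l + 1"
    and "\<beta> \<delta> l = Theta a \<delta> 0 + Theta a \<delta> l - Lam a \<delta> l - 1" for \<delta> l
  have all_le: "\<forall>\<^sub>F \<delta> in at_right (0::real). \<forall>l. \<bar>\<alpha> \<delta> l\<bar> \<le> 4 \<and> \<bar>\<beta> \<delta> l\<bar> \<le> 4 \<and> \<bar>Lam a \<delta> l - 1\<bar> \<le> 4"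
    using bound
  proof eventually_elim
    case (elim \<delta>)
    show ?case
    proof
      fix l show "\<bar>\<alpha> \<delta> l\<bar> \<le> 4 \<and> \<bar>\<beta> \<delta> l\<bar> \<le> 4 \<and> \<bar>Lam a \<delta> l - 1\<bar> \<le> 4"
        using elim[rule_format, of l] elim[rule_format, of 0] unfolding \<alpha>_def \<beta>_def by linarith
    qed
  qed
  then have all_le': "\<forall>\<^sub>F \<delta> in at_right 0. \<forall>l. \<bar>\<beta> \<delta> l\<bar> \<le> 4 \<and> \<bar>\<alpha> \<delta> l\<bar> \<le> 4 \<and> \<bar>Lam a \<delta> l - 1\<bar> \<le> 4"
    by (rule eventually_mono) auto
  have ab_lim: "((\<lambda>\<delta>. \<alpha> \<delta> l) \<longlongrightarrow> 0) (at_right 0)" "((\<lambda>\<delta>. \<beta> \<delta> l) \<longlongrightarrow> 0) (at_right 0)" for l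
    unfolding \<alpha>_def \<beta>_def by (auto intro!: tendsto_eq_intros lims)
  show ?thesis
  proof (intro conjI ballI)
    fix V assume "V \<in> sobolev_vector Y s"
    then obtain Vs Vt Vx where V: "V = (Vs, Vt, Vx)" "vector_norm s (Vs, Vt, Vx) < \<infinity>"
      by (cases V) (auto simp: sobolev_vector_def)
    have "nonlocal_div a \<delta> V - local_div V = (\<lambda>l m. of_real (Lam a \<delta> l - 1) * ll1 l * - Vs l m)" for \<delta>
      by (simp add: V nonlocal_div_def local_div_def fun_eq_iff algebra_simps)
    then show "((\<lambda>\<delta>. scalar_norm (s - 1) (nonlocal_div a \<delta> V - local_div V)) \<longlongrightarrow> 0) (at_right 0)"
      using scalar_norm_tendsto_0[OF V(2) _ Lam_le Lam_lim, of "\<lambda>l m. - Vs l m"] by simp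
    have "nonlocal_surface_curl a \<delta> V - local_surface_curl V
        = (\<lambda>l m. of_real (Lam a \<delta> l - 1) * ll1 l * Vt l m)" for \<delta>
      by (simp add: V nonlocal_surface_curl_def local_surface_curl_def fun_eq_iff algebra_simps)
    then show "((\<lambda>\<delta>. scalar_norm (s - 1) (nonlocal_surface_curl a \<delta> V - local_surface_curl V)) \<longlongrightarrow> 0) (at_right 0)"
      using scalar_norm_tendsto_0[OF V(2) _ Lam_le Lam_lim, of Vt] by simp
    have "nonlocal_curl a \<delta> V - local_curl V = (tang (\<lambda>l m. of_real (\<alpha> \<delta> l) * Vt l m),
        tang (\<lambda>l m. of_real (\<beta> \<delta> l) * Vs l m - of_real (Lam a \<delta> l - 1) * Vx l m),
        \<lambda>l m. - (of_real (Lam a \<delta> l - 1) * ll1 l * Vt l m))" for \<delta>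
      by (simp add: V nonlocal_curl_def local_curl_def tang_def \<alpha>_def \<beta>_def fun_eq_iff algebra_simps)
    then show "((\<lambda>\<delta>. vector_norm (s - 1) (nonlocal_curl a \<delta> V - local_curl V)) \<longlongrightarrow> 0) (at_right 0)"
      using vector_norm_tendsto_0[OF V(2) all_le ab_lim Lam_lim] by simp
    \<comment> \<open>In the adjoint the two tangential multipliers trade places, hence the
      exchanged bound and limits.\<close>
    have "nonlocal_curl_adj a \<delta> V - local_curl_adj V = (tang (\<lambda>l m. of_real (\<beta> \<delta> l) * Vt l m),
        tang (\<lambda>l m. of_real (\<alpha> \<delta> l) * Vs l m - of_real (Lam a \<delta> l - 1) * Vx l m),
        \<lambda>l m. - (of_real (Lam a \<delta> l - 1) * ll1 l * Vt l m))" for \<delta>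
      by (simp add: V nonlocal_curl_adj_def local_curl_adj_def tang_def \<alpha>_def \<beta>_def fun_eq_iff algebra_simps)
    then show "((\<lambda>\<delta>. vector_norm (s - 1) (nonlocal_curl_adj a \<delta> V - local_curl_adj V)) \<longlongrightarrow> 0) (at_right 0)"
      using vector_norm_tendsto_0[OF V(2) all_le' ab_lim(2,1) Lam_lim] by simp
  next
    fix u assume "u \<in> sobolev_scalar Y s"
    then have u: "scalar_norm s u < \<infinity>" by (simp add: sobolev_scalar_def)
    note T = tangential_norm_tendsto_0[OF u Lam_le Lam_lim]
    have "nonlocal_grad a \<delta> u - local_grad u = (tang (\<lambda>l m. of_real (Lam a \<delta> l - 1) * u l m), \<lambda>l m. 0)" for \<delta>
      by (simp add: nonlocal_grad_def local_grad_def tang_def fun_eq_iff algebra_simps)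
    then show "((\<lambda>\<delta>. tangential_norm (s - 1) (nonlocal_grad a \<delta> u - local_grad u)) \<longlongrightarrow> 0) (at_right 0)"
      using T by simp
    have "nonlocal_rotated_grad a \<delta> u - local_rotated_grad u
        = (\<lambda>l m. 0, tang (\<lambda>l m. of_real (Lam a \<delta> l - 1) * u l m))" for \<delta>
      by (simp add: nonlocal_rotated_grad_def local_rotated_grad_def tang_def fun_eq_iff algebra_simps)
    \<comment> \<open>The tangential norm is symmetric in its two components, so the gradient case
      carries over.\<close>
    then show "((\<lambda>\<delta>. tangential_norm (s - 1) (nonlocal_rotated_grad a \<delta> u - local_rotated_grad u)) \<longlongrightarrow> 0) (at_right 0)"
      using T by (simp add: tangential_norm_def add.commute)
  qed
qed

end
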